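(* Let $G$ be a local analytic Moufang loop with unit $e$ and tangent algebra $\Gamma=T_e(G)$, let $(S,T)$ be a (local, analytic) action of $G$ by Moufang transformations on an analytic manifold $\mathfrak{X}$, let $S_x,T_x,P_x$ ($x\in\Gamma$) be the associated infinitesimal Moufang transformations (vector fields on $\mathfrak X$, with $S_x+T_x+P_x=0$), let $Y(x;y)$ be the Yamagutian, defined by $6Y(x;y)=[S_x,S_y]+[T_x,T_y]+[P_x,P_y]$, and let $[x,y,z]$ be the Yamaguti bracket on $\Gamma$. Then for all $x,y,z\in\Gamma$: $$6[Y(x;y),S_z]=S_{[x,y,z]},$$ $$6[Y(x;y),T_z]=T_{[x,y,z]},$$ $$6[Y(x;y),P_z]=P_{[x,y,z]}.$$
   Context: A Moufang loop is a loop (quasigroup with unit $e$) satisfying $(gh)(kg)=g((hk)g)$ for all $g,h,k$. $G$ is a local analytic Moufang loop: multiplication is defined and analytic near $e$; local coordinates $g^i$ are chosen with $e^i=0$. Tangent algebra: $\Gamma=T_e(G)$ with bracket $[x,y]^i=C^i_{jk}x^jy^k$, where $C^i_{jk}=\frac{\partial^2(gh)^i}{\partial g^j\partial h^k}\big|_{g=h=e}-\frac{\partial^2(gh)^i}{\partial g^k\partial h^j}\big|_{g=h=e}$. Action by Moufang transformations: a pair $(S,T)$ of maps from $G$ to (local) transformations of $\mathfrak X$, $g\mapsto S_g,T_g$, with $S_gA$ and $T_gA$ analytic in $(g,A)$, such that for all $g,h\in G$ (near $e$) $$S_e=T_e=\mathrm{id},\qquad S_gT_gS_h=S_{gh}T_g,\qquad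 S_gT_gT_h=T_{hg}S_g .$$ Infinitesimal Moufang transformations: in local coordinates $A^\mu$ of $\mathfrak X$ put $S^\mu_j(A)=\frac{\partial (S_gA)^\mu}{\partial g^j}\big|_{g=e}$, $T^\mu_j(A)=\frac{\partial (T_gA)^\mu}{\partial g^j}\big|_{g=e}$, and define $P^\mu_j$ by $S^\mu_j+T^\mu_j+P^\mu_j=0$. For $x\in\Gamma$, $S_x=x^jS^\nu_j(A)\frac{\partial}{\partial A^\nu}$, $T_x=x^jT^\nu_j(A)\frac{\partial}{\partial A^\nu}$, $P_x=x^jP^\nu_j(A)\frac{\partial}{\partial A^\nu}$, so $S_x+T_x+P_x=0$. Brackets of vector fields are Lie brackets with the sign convention $[X,Z]^\mu=Z^\nu\frac{\partial X^\mu}{\partial A^\nu}-X^\nu\frac{\partial Z^\mu}{\partial A^\nu}$. Yamaguti bracket: let $u^s_j(g)=\frac{\partial (hg)^s}{\partial h^j}\big|_{h=e}$, $v^s_j(g)=\frac{\partial (gh)^s}{\partial h^j}\big|_{h=e}$, $w^s_j=-u^s_j-v^s_j$; for $f\in\{u,v,w\}$ let $f^i_{jk}(g)=f^s_k(g)\frac{\partial f^i_j(g)}{\partial g^s}-f^s_j(g)\frac{\partial f^i_k(g)}{\partial g^s}$; let $6Y^i_{jk}(g)=u^i_{jk}(g)+v^i_{jk}(g)+w^i_{jk}(g)$ and $Y^i_{jk}(g)=Y^i_{jkl}g^l+O(g^2)$. Then $[x,y,z]^i=6Y^i_{jkl}x^jy^kz^l$; equivalently, in terms of the bracket of $\Gamma$,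 $$[x,y,z]=[x,[y,z]]-[y,[x,z]]+[[x,y],z].$$ *)

theory Defs
  imports "HOL-Analysis.Analysis"
begin

subsection \<open>Real analytic maps and partial derivatives\<close>

text \<open>
  Real analyticity on a (usually open) set: near each point the map is the sum of an
  unconditionally convergent power series, indexed by multi-indices on the standard basis.
\<close>

definition real_analytic_at :: "('a::euclidean_space \<Rightarrow> 'b::euclidean_space) \<Rightarrow> 'a \<Rightarrow> bool" where
  "real_analytic_at f a \<longleftrightarrow>
     (\<exists>(c :: ('a \<Rightarrow> nat) \<Rightarrow> 'b). \<exists>r>0. \<forall>x\<in>ball a r.
        ((\<lambda>\<alpha>. (\<Prod>b\<in>Basis. ((x - a) \<bullet> b) ^ \<alpha> b) *\<^sub>R c \<alpha>) has_sum f x) (Basis \<rightarrow>\<^sub>E UNIV))"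

definition real_analytic_on :: "('a::euclidean_space \<Rightarrow> 'b::euclidean_space) \<Rightarrow> 'a set \<Rightarrow> bool" where
  "real_analytic_on f A \<longleftrightarrow> (\<forall>a\<in>A. real_analytic_at f a)"

definition partial_deriv :: "'n::finite \<Rightarrow> (real^'n \<Rightarrow> 'b::real_normed_vector) \<Rightarrow> real^'n \<Rightarrow> 'b" where
  "partial_deriv j f a = vector_derivative (\<lambda>t. f (a + t *\<^sub>R axis j 1)) (at 0)"

text \<open>
  Vector fields are given by their components in coordinates.  The sign convention is
  \<open>[X,Z] = Z\<^sup>\<nu> \<partial>\<^sub>\<nu> X - X\<^sup>\<nu> \<partial>\<^sub>\<nu> Z\<close>, opposite to the usual one.
\<close>

definition vf_bracket ::
    "(real^'m \<Rightarrow> real^'m) \<Rightarrow> (real^'m \<Rightarrow> real^'m) \<Rightarrow> real^'m \<Rightarrow> real^'m::finite" where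
  "vf_bracket X Z a =
     (\<Sum>\<nu>\<in>UNIV. (Z a $ \<nu>) *\<^sub>R partial_deriv \<nu> X a - (X a $ \<nu>) *\<^sub>R partial_deriv \<nu> Z a)"


subsection \<open>Local analytic Moufang loops\<close>

text \<open>
  The loop is given in local coordinates with unit \<open>0\<close>.  The product \<open>m\<close> is a total function,
  but only its germ at \<open>(0,0)\<close> is constrained, so all laws are required only near the unit.
  The third conjunct is the local form of the quasigroup property.
\<close>

definition local_analytic_moufang_loop :: "(real^'n \<Rightarrow> real^'n \<Rightarrow> real^'n::finite) \<Rightarrow> bool" where
  "local_analytic_moufang_loop m \<longleftrightarrow>
     (\<exists>U. open U \<and> 0 \<in> U \<and> real_analytic_on (\<lambda>(g, h). m g h) (U \<times> U)) \<and>
     (\<forall>\<^sub>F g in nhds 0. m 0 g = g \<and> m g 0 = g) \<and>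
     (\<exists>W. open W \<and> 0 \<in> W \<and>
        (\<forall>\<^sub>F (a, b) in nhds (0, 0).
           (\<exists>!x. x \<in> W \<and> m a x = b) \<and> (\<exists>!y. y \<in> W \<and> m y a = b))) \<and>
     (\<forall>\<^sub>F (g, h, k) in nhds (0, 0, 0). m (m g h) (m k g) = m g (m (m h k) g))"

definition loop_u :: "(real^'n \<Rightarrow> real^'n \<Rightarrow> real^'n) \<Rightarrow> 'n \<Rightarrow> real^'n \<Rightarrow> real^'n::finite" where
  "loop_u m j g = partial_deriv j (\<lambda>h. m h g) 0"

definition loop_v :: "(real^'n \<Rightarrow> real^'n \<Rightarrow> real^'n) \<Rightarrow> 'n \<Rightarrow> real^'n \<Rightarrow> real^'n::finite" where
  "loop_v m j g = partial_deriv j (\<lambda>h. m g h) 0"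

definition loop_w :: "(real^'n \<Rightarrow> real^'n \<Rightarrow> real^'n) \<Rightarrow> 'n \<Rightarrow> real^'n \<Rightarrow> real^'n::finite" where
  "loop_w m j g = - loop_u m j g - loop_v m j g"

text \<open>
  The functions \<open>f\<^sup>i\<^sub>j\<^sub>k\<close> for \<open>f = u, v, w\<close> are the components of \<open>vf_bracket (f\<^sub>j) (f\<^sub>k)\<close>.
\<close>

definition loop_Y :: "(real^'n \<Rightarrow> real^'n \<Rightarrow> real^'n) \<Rightarrow> 'n \<Rightarrow> 'n \<Rightarrow> real^'n \<Rightarrow> real^'n::finite" where
  "loop_Y m j k g = (1/6) *\<^sub>R
     (vf_bracket (loop_u m j) (loop_u m k) g
      + vf_bracket (loop_v m j) (loop_v m k) g
      + vf_bracket (loop_w m j) (loop_w m k) g)"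

text \<open>
  The partial derivative is the coefficient \<open>Y\<^sup>i\<^sub>j\<^sub>k\<^sub>l\<close> of the linear part of
  \<open>Y\<^sup>i\<^sub>j\<^sub>k\<close> at the unit.
\<close>

definition yamaguti_bracket ::
    "(real^'n \<Rightarrow> real^'n \<Rightarrow> real^'n) \<Rightarrow> real^'n \<Rightarrow> real^'n \<Rightarrow> real^'n \<Rightarrow> real^'n::finite" where
  "yamaguti_bracket m x y z =
     (\<Sum>j\<in>UNIV. \<Sum>k\<in>UNIV. \<Sum>l\<in>UNIV.
        (6 * (x $ j) * (y $ k) * (z $ l)) *\<^sub>R partial_deriv l (loop_Y m j k) 0)"


subsection \<open>Analytic manifolds\<close>

text \<open>A chart is a pair of its domain and its coordinate map, the latter only relevant there.\<close>

type_synonym ('x, 'm) chart = "'x set \<times> ('x \<Rightarrow> real^'m)"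

definition is_chart :: "('x::topological_space, 'm::finite) chart \<Rightarrow> bool" where
  "is_chart = (\<lambda>(U, \<phi>). open U \<and> open (\<phi> ` U) \<and> homeomorphism U (\<phi> ` U) \<phi> (inv_into U \<phi>))"

definition analytic_atlas :: "('x::topological_space, 'm::finite) chart set \<Rightarrow> bool" where
  "analytic_atlas \<A> \<longleftrightarrow>
     (\<Union>(U, \<phi>)\<in>\<A>. U) = UNIV \<and>
     (\<forall>c\<in>\<A>. is_chart c) \<and>
     (\<forall>(U, \<phi>)\<in>\<A>. \<forall>(V, \<psi>)\<in>\<A>. real_analytic_on (\<lambda>a. \<psi> (inv_into U \<phi> a)) (\<phi> ` (U \<inter> V)))"


subsection \<open>Actions by Moufang transformations\<close>

text \<open>
  A family \<open>F\<close> of local transformations, indexed by a neighbourhood of \<open>0\<close>, such that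
  \<open>F g A\<close> is (defined and) analytic in \<open>(g, A)\<close> near \<open>(0, A\<^sub>0)\<close> for every point \<open>A\<^sub>0\<close>.
  The neighbourhood of \<open>0\<close> may depend on \<open>A\<^sub>0\<close>.  The formula is meant for families with
  \<open>F 0 A = A\<close>, so that one chart serves for both the argument and the value.
\<close>

definition analytic_family ::
    "('x::topological_space, 'm::finite) chart set \<Rightarrow> (real^'n \<Rightarrow> 'x \<Rightarrow> 'x) \<Rightarrow> bool" where
  "analytic_family \<A> F \<longleftrightarrow>
     (\<forall>(U, \<phi>)\<in>\<A>. \<forall>A\<in>U.
        \<exists>N. open N \<and> (0, \<phi> A) \<in> N \<and> N \<subseteq> UNIV \<times> \<phi> ` U \<and>
            (\<forall>(g, a)\<in>N. F g (inv_into U \<phi> a) \<in> U) \<and>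
            real_analytic_on (\<lambda>(g, a). \<phi> (F g (inv_into U \<phi> a))) N)"

definition moufang_action ::
    "(real^'n \<Rightarrow> real^'n \<Rightarrow> real^'n) \<Rightarrow> ('x::topological_space, 'm::finite) chart set
     \<Rightarrow> (real^'n::finite \<Rightarrow> 'x \<Rightarrow> 'x) \<Rightarrow> (real^'n \<Rightarrow> 'x \<Rightarrow> 'x) \<Rightarrow> bool" where
  "moufang_action m \<A> S T \<longleftrightarrow>
     (\<forall>A. S 0 A = A \<and> T 0 A = A) \<and>
     analytic_family \<A> S \<and> analytic_family \<A> T \<and>
     (\<forall>A\<^sub>0. \<forall>\<^sub>F (g, h, A) in nhds (0, 0, A\<^sub>0).
        S g (T g (S h A)) = S (m g h) (T g A) \<and>
        S g (T g (T h A)) = T (m h g) (S g A))"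

text \<open>
  The vector field \<open>F\<^sub>x = x\<^sup>j F\<^sup>\<nu>\<^sub>j \<partial>\<^sub>\<nu>\<close> of a family \<open>F\<close>, in the coordinates of a chart.
\<close>

definition inf_transf ::
    "('x, 'm::finite) chart \<Rightarrow> (real^'n::finite \<Rightarrow> 'x \<Rightarrow> 'x) \<Rightarrow> real^'n \<Rightarrow> real^'m \<Rightarrow> real^'m" where
  "inf_transf = (\<lambda>(U, \<phi>) F x a.
     \<Sum>j\<in>UNIV. (x $ j) *\<^sub>R partial_deriv j (\<lambda>g. \<phi> (F g (inv_into U \<phi> a))) 0)"

definition inf_transf_P ::
    "('x, 'm::finite) chart \<Rightarrow> (real^'n::finite \<Rightarrow> 'x \<Rightarrow> 'x) \<Rightarrow> (real^'n \<Rightarrow> 'x \<Rightarrow> 'x)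
     \<Rightarrow> real^'n \<Rightarrow> real^'m \<Rightarrow> real^'m" where
  "inf_transf_P c S T x a = - inf_transf c S x a - inf_transf c T x a"

definition yamagutian ::
    "('x, 'm::finite) chart \<Rightarrow> (real^'n::finite \<Rightarrow> 'x \<Rightarrow> 'x) \<Rightarrow> (real^'n \<Rightarrow> 'x \<Rightarrow> 'x)
     \<Rightarrow> real^'n \<Rightarrow> real^'n \<Rightarrow> real^'m \<Rightarrow> real^'m" where
  "yamagutian c S T x y a = (1/6) *\<^sub>R
     (vf_bracket (inf_transf c S x) (inf_transf c S y) a
      + vf_bracket (inf_transf c T x) (inf_transf c T y) a
      + vf_bracket (inf_transf_P c S T x) (inf_transf_P c S T y) a)"

end

theory Submission
  imports Defs
begin

text \<open>
  Differentiating the action identities twice at the unit gives, with \<open>D(x,y) = [S\<^sub>x,T\<^sub>y]\<close>,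
  the relations \<open>[S\<^sub>x,S\<^sub>y] = S\<^bsub>[x,y]\<^esub> - 2D(x,y)\<close>, \<open>[T\<^sub>x,T\<^sub>y] = -T\<^bsub>[x,y]\<^esub> - 2D(x,y)\<close> and
  \<open>D(x,y) = -D(y,x)\<close>, hence \<open>6Y(x;y) = 2S\<^bsub>[x,y]\<^esub> - 2T\<^bsub>[x,y]\<^esub> - 6D(x,y)\<close>.  The Jacobi identities of
  \<open>S\<^sub>x,S\<^sub>y,S\<^sub>z,T\<^sub>x,T\<^sub>y,T\<^sub>z\<close> are then linear equations that determine \<open>[D(x,y),S\<^sub>z]\<close> and
  \<open>[D(x,y),T\<^sub>z]\<close>, and yield \<open>6[Y(x;y),S\<^sub>z] = S\<^sub>w\<close> and \<open>6[Y(x;y),T\<^sub>z] = T\<^sub>w\<close> with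
  \<open>w = [[x,y],z] - [[y,z],x] - [[z,x],y]\<close>.  By the Moufang identity the left and right translations
  of the loop form an action of the loop on itself, whose Yamagutian vanishes at the unit; the
  relation for this action, evaluated at the unit, says that \<open>w\<close> is the Yamaguti bracket \<open>[x,y,z]\<close>.
\<close>

subsection \<open>Derivatives of real analytic maps\<close>

text \<open>The relations have two sources. With \<open>h = e\<close> the second action identity
  says that \<open>S_g\<close> and \<open>T_g\<close> commute; its second derivative in
  \<open>g\<close> is the skew-symmetry of \<open>D\<close>. The full identities are differentiated
  once in \<open>h\<close> and once in \<open>g\<close>. The result contains a second parameter
  derivative of the family, symmetric in \<open>x\<close> and \<open>y\<close>, so comparing the two
  orders removes it and turns the mixed derivative of the product into \<open>[x,y]\<close>; the two
  copies of \<open>D\<close> that remain agree by skew-symmetry, whence the factor 2. The tangent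
  algebra need not be a Lie algebra, so its Jacobian \<open>J\<close> stays in the equations, and
  \<open>w\<close> is twice \<open>[[x,y],z]\<close> minus \<open>J\<close>. The Yamaguti bracket is
  defined through derivatives of \<open>u\<close>, \<open>v\<close>, \<open>w\<close> and not
  through brackets of the tangent algebra. But \<open>u\<close> and \<open>v\<close> are the vector
  fields of left and right translation, so the functions defining it are the Yamagutian of the loop
  acting on itself, and the general formula can be applied to them.\<close>

lemma has_sum_diff:
  fixes f g :: "'i \<Rightarrow> 'b::topological_ab_group_add"
  assumes "(f has_sum a) I" "(g has_sum b) I"
  shows "((\<lambda>i. f i - g i) has_sum (a - b)) I"
  using has_sum_add[OF assms(1), of "\<lambda>i. - g i" "- b"] assms(2) by (simp add: has_sum_uminus)

text \<open>The mean value inequality on the convex set \<open>S\<close> bounds each normalised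
  remainder by \<open>2 * M i\<close>. By the Weierstrass test the remainders sum uniformly, so
  their limit at \<open>x\<close>, which is 0 for each term, passes through the sum.\<close>

lemma has_derivative_has_sum:
  fixes \<phi> :: "'i \<Rightarrow> 'a::real_normed_vector \<Rightarrow> 'b::banach"
  assumes S: "convex S" "open S" "x \<in> S"
    and der: "\<And>i y. i \<in> I \<Longrightarrow> y \<in> S \<Longrightarrow> (\<phi> i has_derivative \<phi>' i y) (at y)"
    and bd: "\<And>i y h. i \<in> I \<Longrightarrow> y \<in> S \<Longrightarrow> norm (\<phi>' i y h) \<le> M i * norm h"
    and M: "M summable_on I" and M0: "\<And>i. i \<in> I \<Longrightarrow> 0 \<le> M i"
    and f: "\<And>y. y \<in> S \<Longrightarrow> ((\<lambda>i. \<phi> i y) has_sum f y) I"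
  shows "(f has_derivative (\<lambda>h. \<Sum>\<^sub>\<infinity>i\<in>I. \<phi>' i x h)) (at x)"
proof -
  define A where "A = (\<lambda>h. \<Sum>\<^sub>\<infinity>i\<in>I. \<phi>' i x h)"
  have lin: "bounded_linear (\<phi>' i x)" if "i \<in> I" for i
    using der[OF that S(3)] by (rule has_derivative_bounded_linear)
  have Mh: "((\<lambda>i. M i * norm h) has_sum infsum M I * norm h) I" for h :: 'a
    by (intro has_sum_cmult_left has_sum_infsum M)
  have sm: "(\<lambda>i. norm (\<phi>' i x h)) summable_on I" for h
    by (rule Infinite_Sum.abs_summable_on_comparison_test'[OF has_sum_imp_summable[OF Mh[of h]]])
      (use bd S(3) in auto)
  have A: "((\<lambda>i. \<phi>' i x h) has_sum A h) I" for h
    unfolding A_def by (rule has_sum_infsum[OF Infinite_Sum.abs_summable_summable[OF sm]])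
  have blA: "bounded_linear A"
  proof
    fix h k :: 'a and r :: real
    have "((\<lambda>i. \<phi>' i x (h + k)) has_sum (A h + A k)) I"
      using has_sum_add[OF A A, of h k]
      by (rule has_sum_cong[THEN iffD1, rotated]) (auto simp: linear_add[OF bounded_linear.linear[OF lin]])
    then show "A (h + k) = A h + A k"
      using A has_sum_unique by blast
    have "((\<lambda>i. \<phi>' i x (r *\<^sub>R h)) has_sum (r *\<^sub>R A h)) I"
      using has_sum_scaleR[OF A, of r h]
      by (rule has_sum_cong[THEN iffD1, rotated]) (auto simp: linear_scale[OF bounded_linear.linear[OF lin]])
    then show "A (r *\<^sub>R h) = r *\<^sub>R A h"
      using A has_sum_unique by blast
  next
    have "norm (A h) \<le> norm h * infsum M I" for h
      using norm_infsum_le[OF A Mh, of h h] bd S(3) by (simp add: mult.commute)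
    then show "\<exists>K. \<forall>h. norm (A h) \<le> norm h * K" by blast
  qed
  define R where "R = (\<lambda>i y. (\<phi> i y - \<phi> i x - \<phi>' i x (y - x)) /\<^sub>R norm (y - x))"
  have Rbd: "norm (R i y) \<le> 2 * M i" if i: "i \<in> I" and y: "y \<in> S" for i y
  proof -
    have on: "onorm (\<phi>' i z) \<le> M i" if "z \<in> S" for z
      using bd[OF i that] M0[OF i] by (intro onorm_bound) (auto simp: mult.commute)
    have "norm (\<phi> i y - \<phi> i x) \<le> M i * norm (y - x)"
      by (rule differentiable_bound[OF S(1) has_derivative_at_withinI[OF der[OF i]] on y S(3)])
    moreover have "norm (\<phi>' i x (y - x)) \<le> M i * norm (y - x)"
      using bd i S(3) by blast
    ultimately have "norm (\<phi> i y - \<phi> i x - \<phi>' i x (y - x)) \<le> 2 * M i * norm (y - x)"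
      using norm_triangle_ineq4[of "\<phi> i y - \<phi> i x" "\<phi>' i x (y - x)"] by linarith
    then show ?thesis
      using M0[OF i] by (cases "y = x") (auto simp: R_def divide_simps mult_ac)
  qed
  have Rsum: "((\<lambda>i. R i y) has_sum (f y - f x - A (y - x)) /\<^sub>R norm (y - x)) I" if "y \<in> S" for y
  proof -
    have "((\<lambda>i. \<phi> i y - \<phi> i x - \<phi>' i x (y - x)) has_sum (f y - f x - A (y - x))) I"
      by (intro has_sum_diff f that S(3) A)
    then show ?thesis unfolding R_def by (rule has_sum_scaleR)
  qed
  have "uniform_limit S (\<lambda>J y. \<Sum>i\<in>J. R i y) (\<lambda>y. (f y - f x - A (y - x)) /\<^sub>R norm (y - x))
      (finite_subsets_at_top I)"
    by (rule Weierstrass_m_test_general'[OF Rbd Rsum])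
      (auto intro: summable_on_cmult_right M)
  then have "((\<lambda>y. (f y - f x - A (y - x)) /\<^sub>R norm (y - x)) \<longlongrightarrow> 0) (at x)"
  proof (rule swap_uniform_limit'[rotated 2])
    show "\<forall>\<^sub>F J in finite_subsets_at_top I. ((\<lambda>y. \<Sum>i\<in>J. R i y) \<longlongrightarrow> 0) (at x)"
    proof (rule eventually_finite_subsets_at_top_weakI)
      fix J assume "finite J" "J \<subseteq> I"
      then have "((\<lambda>y. \<Sum>i\<in>J. R i y) \<longlongrightarrow> (\<Sum>i\<in>J. 0)) (at x)"
        using der[OF _ S(3)] by (intro tendsto_sum) (auto simp: R_def has_derivative_at_within)
      then show "((\<lambda>y. \<Sum>i\<in>J. R i y) \<longlongrightarrow> 0) (at x)" by simp
    qed
    show "\<forall>\<^sub>F y in at x. y \<in> S"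
      using S by (simp add: eventually_at_in_open')
  qed auto
  then show ?thesis
    using blA unfolding A_def[symmetric] by (simp add: has_derivative_at_within)
qed

lemma has_sum_sum:
  fixes f :: "'j \<Rightarrow> 'i \<Rightarrow> 'b::topological_comm_monoid_add"
  assumes "\<And>j. j \<in> J \<Longrightarrow> (f j has_sum s j) I"
  shows "((\<lambda>i. \<Sum>j\<in>J. f j i) has_sum (\<Sum>j\<in>J. s j)) I"
  using assms by (induction J rule: infinite_finite_induct) (auto intro!: has_sum_add)

text \<open>Unconditional and absolute summability agree for real families, hence, coordinate by
  coordinate, in finite dimension. This makes the \<open>has_sum\<close> in the definition of
  analyticity usable for domination.\<close>

lemma summable_on_imp_abs_summable_on_euclidean:
  fixes f :: "'i \<Rightarrow> 'b::euclidean_space"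
  assumes "f summable_on I"
  shows "(\<lambda>i. norm (f i)) summable_on I"
proof -
  have "(\<lambda>i. norm (f i \<bullet> b)) summable_on I" for b
    using summable_on_bounded_linear[OF bounded_linear_inner_left assms, of b]
    by (subst summable_on_iff_abs_summable_on_real[symmetric]) (simp add: o_def)
  then have "(\<lambda>i. \<Sum>b\<in>Basis. norm (f i \<bullet> b)) summable_on I"
    by (rule has_sum_imp_summable[OF has_sum_sum[OF has_sum_infsum]])
  then show ?thesis
    by (rule Infinite_Sum.abs_summable_on_comparison_test') (use norm_le_l1 in auto)
qed

definition monomial_at :: "'a::euclidean_space \<Rightarrow> ('a \<Rightarrow> nat) \<Rightarrow> 'a \<Rightarrow> real" where
  "monomial_at a \<alpha> x = (\<Prod>b\<in>Basis. ((x - a) \<bullet> b) ^ \<alpha> b)"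

text \<open>The truncated subtraction \<open>\<alpha> e - 1\<close> is harmless: for
  \<open>\<alpha> e = 0\<close> the coefficient \<open>real (\<alpha> e)\<close> vanishes.\<close>

lemma monomial_at_has_derivative:
  "(monomial_at a \<alpha> has_derivative
     (\<lambda>h. \<Sum>e\<in>Basis. (real (\<alpha> e) * monomial_at a (\<alpha>(e := \<alpha> e - 1)) x) * (h \<bullet> e))) (at x)"
proof -
  have eq: "monomial_at a \<alpha> = (\<lambda>x. \<Prod>b\<in>Basis. ((x - a) \<bullet> b) ^ \<alpha> b)"
    by (simp add: fun_eq_iff monomial_at_def)
  have 1: "((\<lambda>x. \<Prod>b\<in>Basis. ((x - a) \<bullet> b) ^ \<alpha> b) has_derivative
     (\<lambda>h. \<Sum>e\<in>Basis. (real (\<alpha> e) * (h \<bullet> e) * ((x - a) \<bullet> e) ^ (\<alpha> e - 1))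
        * (\<Prod>b\<in>Basis - {e}. ((x - a) \<bullet> b) ^ \<alpha> b))) (at x)"
    by (rule has_derivative_prod) (auto intro!: derivative_eq_intros simp: inner_diff_left)
  have 2: "((x - a) \<bullet> e) ^ (\<alpha> e - 1) * (\<Prod>b\<in>Basis - {e}. ((x - a) \<bullet> b) ^ \<alpha> b)
      = monomial_at a (\<alpha>(e := \<alpha> e - 1)) x" if "e \<in> Basis" for e
    unfolding monomial_at_def using that by (subst prod.remove[of Basis e]) auto
  show ?thesis
    unfolding eq
    by (rule has_derivative_eq_rhs[OF 1]) (auto simp: fun_eq_iff mult_ac 2[symmetric, simplified One_nat_def] intro!: sum.cong)
qed

lemma abs_monomial_at_le:
  assumes "\<And>b. b \<in> Basis \<Longrightarrow> \<bar>(x - a) \<bullet> b\<bar> \<le> s"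
  shows "\<bar>monomial_at a \<alpha> x\<bar> \<le> s ^ (\<Sum>b\<in>Basis. \<alpha> b)"
  unfolding monomial_at_def abs_prod power_sum power_abs
  by (rule prod_mono) (auto intro: power_mono assms)

text \<open>Halving the radius pays for the exponent brought down by differentiation: that exponent
  is at most \<open>2 ^ (N + 1)\<close> with \<open>N\<close> the remaining degree, and \<open>2 ^
  (N + 1) * (\<rho> / 2) ^ N = 2 / \<rho> * \<rho> ^ (N + 1)\<close>.\<close>

lemma abs_monomial_at_deriv_le:
  assumes \<rho>: "0 < \<rho>" and x: "\<And>b. b \<in> Basis \<Longrightarrow> \<bar>(x - a) \<bullet> b\<bar> \<le> \<rho> / 2" and e: "e \<in> Basis"
  shows "\<bar>real (\<alpha> e) * monomial_at a (\<alpha>(e := \<alpha> e - 1)) x\<bar> \<le> 2 / \<rho> * \<rho> ^ (\<Sum>b\<in>Basis. \<alpha> b)"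
proof (cases "\<alpha> e")
  case (Suc k)
  define N where "N = (\<Sum>b\<in>Basis. (\<alpha>(e := k)) b)"
  have "N = k + (\<Sum>b\<in>Basis - {e}. \<alpha> b)"
    unfolding N_def sum.remove[OF finite_Basis e] by simp
  then have N: "(\<Sum>b\<in>Basis. \<alpha> b) = Suc N" and "k \<le> N"
    using sum.remove[OF finite_Basis e, of \<alpha>] Suc by simp_all
  have "real (Suc k) \<le> 2 ^ Suc N"
    using \<open>k \<le> N\<close> of_nat_less_two_power[of "Suc N", where 'a = real] by linarith
  then have "real (Suc k) * \<bar>monomial_at a (\<alpha>(e := k)) x\<bar> \<le> 2 ^ Suc N * (\<rho> / 2) ^ N"
    using abs_monomial_at_le[OF x, of "\<alpha>(e := k)"] by (intro mult_mono) (auto simp: N_def)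
  also have "\<dots> = 2 / \<rho> * \<rho> ^ Suc N"
    using \<rho> by (simp add: power_divide)
  finally show ?thesis by (simp add: Suc N abs_mult)
qed (use \<rho> in auto)

text \<open>At the diagonal point \<open>a + \<rho> *\<^sub>R One\<close> every monomial equals
  \<rho> to its degree, so convergence at this single point controls all coefficients.\<close>

lemma real_analytic_at_imp_abs_summable:
  fixes c :: "('a::euclidean_space \<Rightarrow> nat) \<Rightarrow> 'b::euclidean_space"
  assumes r: "0 < r"
    and f: "\<And>x. x \<in> ball a r \<Longrightarrow> ((\<lambda>\<alpha>. monomial_at a \<alpha> x *\<^sub>R c \<alpha>) has_sum f x) (Basis \<rightarrow>\<^sub>E UNIV)"
  obtains \<rho> where "0 < \<rho>" "\<rho> \<le> r"
    "(\<lambda>\<alpha>. \<rho> ^ (\<Sum>b\<in>Basis. \<alpha> b) * norm (c \<alpha>)) summable_on (Basis \<rightarrow>\<^sub>E UNIV)"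
proof -
  \<comment> \<open>As \<open>One\<close> has norm at most \<open>DIM('a)\<close>, the diagonal
    point stays within \<open>r / 2\<close> of \<open>a\<close>.\<close>
  define \<rho> where "\<rho> = r / (2 * DIM('a))"
  have \<rho>: "0 < \<rho>" using r by (simp add: \<rho>_def)
  have "\<rho> \<le> r / 1" unfolding \<rho>_def using r using DIM_positive[where 'a = 'a]
    by (intro divide_left_mono) (auto simp: Suc_le_eq intro: order_trans[of 1 "real DIM('a)"])
  then have "\<rho> \<le> r" by simp
  define x where "x = a + \<rho> *\<^sub>R One"
  have "norm (One :: 'a) \<le> DIM('a)"
    using norm_sum[of "\<lambda>b. b" "Basis :: 'a set"] by simp
  then have "norm (\<rho> *\<^sub>R (One :: 'a)) \<le> \<rho> * DIM('a)"
    using \<rho> by simp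
  also have "\<dots> < r" using r by (simp add: \<rho>_def)
  finally have "x \<in> ball a r" by (simp add: x_def dist_norm)
  from has_sum_imp_summable[OF f[OF this]]
  have "(\<lambda>\<alpha>. norm (monomial_at a \<alpha> x *\<^sub>R c \<alpha>)) summable_on (Basis \<rightarrow>\<^sub>E UNIV)"
    by (rule summable_on_imp_abs_summable_on_euclidean)
  moreover have "monomial_at a \<alpha> x = \<rho> ^ (\<Sum>b\<in>Basis. \<alpha> b)" for \<alpha>
    by (simp add: monomial_at_def x_def power_sum)
  ultimately show thesis
    using that[OF \<rho> \<open>\<rho> \<le> r\<close>] \<rho> by simp
qed

text \<open>Lowering the exponent of \<open>e\<close> maps the multi-indices with
  \<open>\<alpha> e \<noteq> 0\<close>, outside which the terms vanish, bijectively onto all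
  multi-indices. A differentiated power series is thus again a power series about the same
  centre.\<close>

lemma has_sum_shift_exponent:
  fixes c :: "('a::euclidean_space \<Rightarrow> nat) \<Rightarrow> 'b::euclidean_space"
  assumes e: "e \<in> Basis"
    and s: "((\<lambda>\<alpha>. (real (\<alpha> e) * monomial_at a (\<alpha>(e := \<alpha> e - 1)) x) *\<^sub>R c \<alpha>) has_sum s) (Basis \<rightarrow>\<^sub>E UNIV)"
  shows "((\<lambda>\<beta>. monomial_at a \<beta> x *\<^sub>R (real (Suc (\<beta> e)) *\<^sub>R c (\<beta>(e := Suc (\<beta> e))))) has_sum s) (Basis \<rightarrow>\<^sub>E UNIV)"
proof -
  define I :: "('a \<Rightarrow> nat) set" where "I = Basis \<rightarrow>\<^sub>E UNIV"
  define h where "h = (\<lambda>\<beta> :: 'a \<Rightarrow> nat. \<beta>(e := Suc (\<beta> e)))"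
  define g where "g = (\<lambda>\<alpha>. (real (\<alpha> e) * monomial_at a (\<alpha>(e := \<alpha> e - 1)) x) *\<^sub>R c \<alpha>)"
  have hI: "h ` I = {\<alpha> \<in> I. \<alpha> e \<noteq> 0}"
  proof (intro set_eqI iffI)
    fix \<alpha> assume "\<alpha> \<in> {\<alpha> \<in> I. \<alpha> e \<noteq> 0}"
    then have "\<alpha> = h (\<alpha>(e := \<alpha> e - 1))" "\<alpha>(e := \<alpha> e - 1) \<in> I"
      using e by (auto simp: h_def I_def PiE_iff extensional_def)
    then show "\<alpha> \<in> h ` I" by blast
  qed (use e in \<open>auto simp: h_def I_def PiE_iff extensional_def\<close>)
  have inj: "inj_on h I"
    by (rule inj_on_inverseI[where g = "\<lambda>\<alpha>. \<alpha>(e := \<alpha> e - 1)"]) (auto simp: h_def)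
  have "(g has_sum s) (h ` I)"
    by (rule has_sum_cong_neutral[THEN iffD1, OF _ _ _ s[folded I_def, folded g_def]])
      (auto simp: hI g_def)
  then have "((g \<circ> h) has_sum s) I"
    using has_sum_reindex[OF inj] by blast
  moreover have "g \<circ> h = (\<lambda>\<beta>. monomial_at a \<beta> x *\<^sub>R (real (Suc (\<beta> e)) *\<^sub>R c (\<beta>(e := Suc (\<beta> e)))))"
    by (auto simp: g_def h_def fun_eq_iff mult.commute)
  ultimately show ?thesis by (simp add: I_def)
qed

text \<open>The functions \<open>g e\<close> are the partial derivatives. Having their expansions on
  the ball where the derivative formula holds lets analyticity pass to the derivative, so that
  differentiation can be repeated.\<close>

lemma real_analytic_at_derivE:
  fixes f :: "'a::euclidean_space \<Rightarrow> 'b::euclidean_space"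
  assumes "real_analytic_at f a"
  obtains r g where "0 < r"
    "\<And>x. x \<in> ball a r \<Longrightarrow> (f has_derivative (\<lambda>h. \<Sum>e\<in>Basis. (h \<bullet> e) *\<^sub>R g e x)) (at x)"
    "\<And>e. e \<in> Basis \<Longrightarrow> \<exists>c. \<forall>x\<in>ball a r. ((\<lambda>\<alpha>. monomial_at a \<alpha> x *\<^sub>R c \<alpha>) has_sum g e x) (Basis \<rightarrow>\<^sub>E UNIV)"
proof -
  define I :: "('a \<Rightarrow> nat) set" where "I = Basis \<rightarrow>\<^sub>E UNIV"
  obtain c r where r: "0 < r"
    and c: "\<And>x. x \<in> ball a r \<Longrightarrow> ((\<lambda>\<alpha>. monomial_at a \<alpha> x *\<^sub>R c \<alpha>) has_sum f x) I"
    using assms unfolding real_analytic_at_def monomial_at_def I_def by blast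
  obtain \<rho> where \<rho>: "0 < \<rho>" "\<rho> \<le> r"
    and sm: "(\<lambda>\<alpha>. \<rho> ^ (\<Sum>b\<in>Basis. \<alpha> b) * norm (c \<alpha>)) summable_on I"
    using real_analytic_at_imp_abs_summable[OF r c[unfolded I_def]] unfolding I_def by blast
  define S where "S = ball a (\<rho> / 2)"
  have S: "\<bar>(x - a) \<bullet> b\<bar> \<le> \<rho> / 2" if "x \<in> S" "b \<in> Basis" for x b
    using Basis_le_norm[of b "x - a"] that by (auto simp: S_def dist_norm norm_minus_commute)
  define d where "d = (\<lambda>e \<alpha> x. (real (\<alpha> e) * monomial_at a (\<alpha>(e := \<alpha> e - 1)) x) *\<^sub>R c \<alpha>)"
  \<comment> \<open>Dominates every partial derivative of the term of index \<alpha> on the ball of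
    radius \<open>\<rho> / 2\<close>.\<close>
  define M where "M = (\<lambda>\<alpha>. 2 / \<rho> * (\<rho> ^ (\<Sum>b\<in>Basis. \<alpha> b) * norm (c \<alpha>)))"
  have dM: "norm (d e \<alpha> x) \<le> M \<alpha>" if "e \<in> Basis" "x \<in> S" for e \<alpha> x
    using mult_right_mono[OF abs_monomial_at_deriv_le[OF \<rho>(1) S[OF that(2)] that(1), of \<alpha>], of "norm (c \<alpha>)"]
    unfolding d_def M_def by (simp only: norm_scaleR mult.assoc norm_ge_zero)
  have Ms: "M summable_on I"
    unfolding M_def by (intro summable_on_cmult_right sm)
  have M0: "0 \<le> M \<alpha>" for \<alpha>
    unfolding M_def using \<rho> by simp
  define g where "g = (\<lambda>e x. \<Sum>\<^sub>\<infinity>\<alpha>\<in>I. d e \<alpha> x)"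
  have g: "((\<lambda>\<alpha>. d e \<alpha> x) has_sum g e x) I" if "e \<in> Basis" "x \<in> S" for e x
    unfolding g_def
    by (rule has_sum_infsum, rule Infinite_Sum.abs_summable_summable,
        rule Infinite_Sum.abs_summable_on_comparison_test'[OF Ms dM[OF that]])
  show thesis
  proof (rule that[of "\<rho> / 2" g])
    fix x assume "x \<in> ball a (\<rho> / 2)"
    then have x: "x \<in> S" by (simp add: S_def)
    have "(f has_derivative (\<lambda>h. \<Sum>\<^sub>\<infinity>\<alpha>\<in>I. \<Sum>e\<in>Basis. (h \<bullet> e) *\<^sub>R d e \<alpha> x)) (at x)"
    proof (rule has_derivative_has_sum[where S = S and M = "\<lambda>\<alpha>. DIM('a) * M \<alpha>"])
      fix \<alpha> y
      show "((\<lambda>y. monomial_at a \<alpha> y *\<^sub>R c \<alpha>) has_derivative (\<lambda>h. \<Sum>e\<in>Basis. (h \<bullet> e) *\<^sub>R d e \<alpha> y)) (at y)"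
        by (rule has_derivative_eq_rhs[OF has_derivative_scaleR_left[OF monomial_at_has_derivative]])
          (auto simp: d_def scaleR_sum_left mult_ac intro!: sum.cong)
      show "((\<lambda>\<alpha>. monomial_at a \<alpha> y *\<^sub>R c \<alpha>) has_sum f y) I" if "y \<in> S"
        using that \<rho> by (intro c) (auto simp: S_def)
      fix h assume y: "y \<in> S"
      have "norm (\<Sum>e\<in>Basis. (h \<bullet> e) *\<^sub>R d e \<alpha> y) \<le> (\<Sum>e\<in>(Basis :: 'a set). norm h * M \<alpha>)"
        by (rule sum_norm_le) (auto intro!: mult_mono Basis_le_norm dM y)
      then show "norm (\<Sum>e\<in>Basis. (h \<bullet> e) *\<^sub>R d e \<alpha> y) \<le> DIM('a) * M \<alpha> * norm h"
        by (simp add: mult_ac)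
    qed (use M0 x Ms in \<open>auto simp: S_def intro!: summable_on_cmult_right\<close>)
    moreover have "(\<Sum>\<^sub>\<infinity>\<alpha>\<in>I. \<Sum>e\<in>Basis. (h \<bullet> e) *\<^sub>R d e \<alpha> x) = (\<Sum>e\<in>Basis. (h \<bullet> e) *\<^sub>R g e x)" for h
      by (intro infsumI has_sum_sum has_sum_scaleR g x)
    ultimately show "(f has_derivative (\<lambda>h. \<Sum>e\<in>Basis. (h \<bullet> e) *\<^sub>R g e x)) (at x)"
      by simp
  next
    fix e :: 'a assume "e \<in> Basis"
    then show "\<exists>c. \<forall>x\<in>ball a (\<rho> / 2). ((\<lambda>\<alpha>. monomial_at a \<alpha> x *\<^sub>R c \<alpha>) has_sum g e x) (Basis \<rightarrow>\<^sub>E UNIV)"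
      using has_sum_shift_exponent[OF _ g[unfolded d_def I_def]] unfolding S_def by meson
  qed (use \<rho> in auto)
qed

lemma real_analytic_at_imp_differentiable:
  "real_analytic_at f a \<Longrightarrow> f differentiable (at a)"
  by (erule real_analytic_at_derivE) (meson centre_in_ball differentiable_def)

lemma real_analytic_at_frechet_derivative:
  assumes "real_analytic_at f a"
  shows "real_analytic_at (\<lambda>x. frechet_derivative f (at x) v) a"
proof (rule real_analytic_at_derivE[OF assms])
  fix r g
  assume r: "0 < r"
    and d: "\<And>x. x \<in> ball a r \<Longrightarrow> (f has_derivative (\<lambda>h. \<Sum>e\<in>Basis. (h \<bullet> e) *\<^sub>R g e x)) (at x)"
    and g: "\<And>e. e \<in> Basis \<Longrightarrow> \<exists>c. \<forall>x\<in>ball a r. ((\<lambda>\<alpha>. monomial_at a \<alpha> x *\<^sub>R c \<alpha>) has_sum g e x) (Basis \<rightarrow>\<^sub>E UNIV)"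
  have "\<forall>e\<in>Basis. \<exists>c. \<forall>x\<in>ball a r. ((\<lambda>\<alpha>. monomial_at a \<alpha> x *\<^sub>R c \<alpha>) has_sum g e x) (Basis \<rightarrow>\<^sub>E UNIV)"
    by (rule ballI) (rule g)
  then obtain c where c: "\<forall>e\<in>Basis. \<forall>x\<in>ball a r.
      ((\<lambda>\<alpha>. monomial_at a \<alpha> x *\<^sub>R c e \<alpha>) has_sum g e x) (Basis \<rightarrow>\<^sub>E UNIV)"
    by (elim bchoice[THEN exE])
  have "((\<lambda>\<alpha>. monomial_at a \<alpha> x *\<^sub>R (\<Sum>e\<in>Basis. (v \<bullet> e) *\<^sub>R c e \<alpha>)) has_sum frechet_derivative f (at x) v)
      (Basis \<rightarrow>\<^sub>E UNIV)" if x: "x \<in> ball a r" for x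
  proof -
    have "((\<lambda>\<alpha>. \<Sum>e\<in>Basis. (v \<bullet> e) *\<^sub>R (monomial_at a \<alpha> x *\<^sub>R c e \<alpha>)) has_sum (\<Sum>e\<in>Basis. (v \<bullet> e) *\<^sub>R g e x))
        (Basis \<rightarrow>\<^sub>E UNIV)"
      by (intro has_sum_sum has_sum_scaleR c[rule_format] x)
    then show ?thesis
      unfolding frechet_derivative_at[OF d[OF x], symmetric]
      by (simp add: scaleR_sum_right mult.commute)
  qed
  then show "real_analytic_at (\<lambda>x. frechet_derivative f (at x) v) a"
    unfolding real_analytic_at_def monomial_at_def
    by (intro exI[of _ "\<lambda>\<alpha>. \<Sum>e\<in>Basis. (v \<bullet> e) *\<^sub>R c e \<alpha>"] exI[of _ r] conjI ballI r)
qed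


subsection \<open>Second derivatives and brackets of vector fields\<close>

abbreviation fderiv :: "('a::real_normed_vector \<Rightarrow> 'b::real_normed_vector) \<Rightarrow> 'a \<Rightarrow> 'a \<Rightarrow> 'b" where
  "fderiv f x \<equiv> frechet_derivative f (at x)"

lemma fderiv_works: "f differentiable (at x) \<Longrightarrow> (f has_derivative fderiv f x) (at x)"
  by (simp add: frechet_derivative_works)

lemma fderiv_eqI: "(f has_derivative f') (at x) \<Longrightarrow> fderiv f x h = f' h"
  using frechet_derivative_at by metis

lemma linear_fderiv: "f differentiable (at x) \<Longrightarrow> linear (fderiv f x)"
  by (rule linear_frechet_derivative)

lemma has_derivative_eventually_cong:
  assumes "(f has_derivative f') (at x)" "\<forall>\<^sub>F y in nhds x. f y = g y"
  shows "(g has_derivative f') (at x)"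
  using assms eventually_nhds_x_imp_x[OF assms(2)]
  by (elim has_derivative_transform_eventually) (auto simp: eventually_at_filter elim: eventually_mono)

lemma fderiv_eventually_cong:
  assumes "f differentiable (at x)" "\<forall>\<^sub>F y in nhds x. f y = g y"
  shows "g differentiable (at x)" "fderiv g x = fderiv f x"
proof -
  have "(g has_derivative fderiv f x) (at x)"
    by (rule has_derivative_eventually_cong[OF fderiv_works[OF assms(1)] assms(2)])
  then show "g differentiable (at x)" "fderiv g x = fderiv f x"
    by (auto simp: differentiable_def dest: frechet_derivative_at)
qed

text \<open>Second derivatives are taken along fixed directions, which avoids a norm on the space of
  linear maps. The first derivatives are asked to be differentiable only at \<open>x\<close> itself;
  this suffices for the symmetry of second derivatives.\<close>

definition twice_differentiable ::
    "('a::real_normed_vector \<Rightarrow> 'b::real_normed_vector) \<Rightarrow> 'a \<Rightarrow> bool" where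
  "twice_differentiable f x \<longleftrightarrow>
     (\<forall>\<^sub>F y in nhds x. f differentiable (at y)) \<and> (\<forall>v. (\<lambda>y. fderiv f y v) differentiable (at x))"

lemma twice_differentiable_imp_differentiable:
  "twice_differentiable f x \<Longrightarrow> f differentiable (at x)"
  unfolding twice_differentiable_def using eventually_nhds_x_imp_x by blast

lemma real_analytic_on_imp_twice_differentiable:
  assumes "real_analytic_on f N" "open N" "x \<in> N"
  shows "twice_differentiable f x"
proof -
  have "\<forall>\<^sub>F y in nhds x. y \<in> N"
    using assms by (simp add: eventually_nhds_in_open)
  then show ?thesis
    using assms unfolding twice_differentiable_def real_analytic_on_def
    by (auto elim!: eventually_mono
        intro: real_analytic_at_imp_differentiable real_analytic_at_frechet_derivative)
qed

text \<open>Product rule for a moving linear map applied to a moving vector. Expanding the vector in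
  the basis reduces it to finitely many products, so it is enough that \<open>L p v\<close> is
  differentiable in \<open>p\<close> for each fixed \<open>v\<close>.\<close>

lemma has_derivative_linear_family:
  fixes L :: "'a::real_normed_vector \<Rightarrow> 'b::euclidean_space \<Rightarrow> 'c::real_normed_vector"
  assumes lin: "\<forall>\<^sub>F p in nhds p0. linear (L p)"
    and L: "\<And>v. (\<lambda>p. L p v) differentiable (at p0)"
    and c: "(c has_derivative c') (at t0)" "c t0 = p0"
    and w: "(w has_derivative w') (at t0)"
  shows "((\<lambda>t. L (c t) (w t)) has_derivative
           (\<lambda>h. fderiv (\<lambda>p. L p (w t0)) p0 (c' h) + L p0 (w' h))) (at t0)"
proof -
  have expand: "(\<Sum>b\<in>Basis. (v \<bullet> b) *\<^sub>R L p b) = L p v" if "linear (L p)" for p v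
  proof -
    have "L p v = L p (\<Sum>b\<in>Basis. (v \<bullet> b) *\<^sub>R b)" by (simp add: euclidean_representation)
    also have "\<dots> = (\<Sum>b\<in>Basis. (v \<bullet> b) *\<^sub>R L p b)"
      using that by (simp add: linear_sum linear_scale)
    finally show ?thesis by simp
  qed
  have lin0: "linear (L p0)" using lin by (rule eventually_nhds_x_imp_x)
  have d: "((\<lambda>p. L p b) has_derivative fderiv (\<lambda>p. L p b) p0) (at p0)" for b
    by (rule fderiv_works[OF L])
  have "((\<lambda>p. \<Sum>b\<in>Basis. (w t0 \<bullet> b) *\<^sub>R L p b) has_derivative
      (\<lambda>h. \<Sum>b\<in>Basis. (w t0 \<bullet> b) *\<^sub>R fderiv (\<lambda>p. L p b) p0 h)) (at p0)"
    by (intro has_derivative_sum has_derivative_scaleR_right d)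
  then have "((\<lambda>p. L p (w t0)) has_derivative
      (\<lambda>h. \<Sum>b\<in>Basis. (w t0 \<bullet> b) *\<^sub>R fderiv (\<lambda>p. L p b) p0 h)) (at p0)"
    by (rule has_derivative_eventually_cong) (use lin expand in \<open>auto elim: eventually_mono\<close>)
  note 1 = fderiv_eqI[OF this]
  have Lc: "((\<lambda>t. L (c t) b) has_derivative (\<lambda>h. fderiv (\<lambda>p. L p b) p0 (c' h))) (at t0)" for b
    using has_derivative_compose[OF c(1), of "\<lambda>p. L p b"] d c(2) by simp
  have "((\<lambda>t. \<Sum>b\<in>Basis. (w t \<bullet> b) *\<^sub>R L (c t) b) has_derivative
      (\<lambda>h. \<Sum>b\<in>Basis. (w t0 \<bullet> b) *\<^sub>R fderiv (\<lambda>p. L p b) p0 (c' h) + (w' h \<bullet> b) *\<^sub>R L (c t0) b)) (at t0)"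
    by (intro has_derivative_sum has_derivative_scaleR has_derivative_inner_left w Lc)
  moreover have "(\<Sum>b\<in>Basis. (w t0 \<bullet> b) *\<^sub>R fderiv (\<lambda>p. L p b) p0 (c' h) + (w' h \<bullet> b) *\<^sub>R L (c t0) b)
      = fderiv (\<lambda>p. L p (w t0)) p0 (c' h) + L p0 (w' h)" for h
    by (simp add: sum.distrib 1 c(2) expand lin0)
  ultimately have "((\<lambda>t. \<Sum>b\<in>Basis. (w t \<bullet> b) *\<^sub>R L (c t) b) has_derivative
      (\<lambda>h. fderiv (\<lambda>p. L p (w t0)) p0 (c' h) + L p0 (w' h))) (at t0)"
    by simp
  moreover have "\<forall>\<^sub>F t in nhds t0. linear (L (c t))"
    using has_derivative_continuous[OF c(1)] c(2) eventually_compose_filterlim[OF lin]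
    unfolding continuous_at tendsto_at_iff_tendsto_nhds by simp
  ultimately show ?thesis
    by (elim has_derivative_eventually_cong) (use expand in \<open>auto elim: eventually_mono\<close>)
qed

lemma has_derivative_fderiv_apply:
  fixes F :: "'a::euclidean_space \<Rightarrow> 'b::real_normed_vector"
  assumes F: "twice_differentiable F p0"
    and c: "(c has_derivative c') (at t0)" "c t0 = p0"
    and w: "(w has_derivative w') (at t0)"
  shows "((\<lambda>t. fderiv F (c t) (w t)) has_derivative
           (\<lambda>h. fderiv (\<lambda>p. fderiv F p (w t0)) p0 (c' h) + fderiv F p0 (w' h))) (at t0)"
  by (rule has_derivative_linear_family[OF _ _ c w])
    (use F in \<open>auto simp: twice_differentiable_def elim: eventually_mono intro: linear_fderiv\<close>)

text \<open>The mean value inequality is applied along \<open>v\<close> to \<open>\<psi>\<close>,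
  the increment in direction \<open>w\<close> less its expected linear part; this uses only
  differentiability at \<open>x\<close> of the derivative along \<open>v\<close>. The difference
  quotient is symmetric in \<open>v\<close> and \<open>w\<close>, and so is its limit.\<close>

lemma second_difference_tendsto:
  fixes f :: "'a::real_normed_vector \<Rightarrow> 'b::real_normed_vector"
  assumes "twice_differentiable f x"
  shows "((\<lambda>t. (f (x + t *\<^sub>R v + t *\<^sub>R w) - f (x + t *\<^sub>R v) - f (x + t *\<^sub>R w) + f x) /\<^sub>R t\<^sup>2)
      \<longlongrightarrow> fderiv (\<lambda>y. fderiv f y v) x w) (at_right 0)"
proof (rule tendstoI)
  fix e :: real assume e: "0 < e"
  define A where "A = fderiv (\<lambda>y. fderiv f y v) x"
  \<comment> \<open>Every point in use lies within \<open>t * K\<close> of \<open>x\<close>; the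
    summand 1 keeps \<open>K\<close> positive when \<open>v\<close> and \<open>w\<close>
    vanish.\<close>
  define K where "K = norm v + norm w + 1"
  have K: "0 < K" unfolding K_def by (simp add: add_nonneg_pos)
  \<comment> \<open>Two errors of size \<open>\<epsilon> * (t * K)\<close>, over a segment of length
    \<open>t\<close>, then add up to \<open>e / 2 * t\<^sup>2\<close>.\<close>
  define \<epsilon> where "\<epsilon> = e / (4 * K)"
  have \<epsilon>: "0 < \<epsilon>" using e K by (simp add: \<epsilon>_def)
  have dA: "((\<lambda>y. fderiv f y v) has_derivative A) (at x)"
    unfolding A_def using assms by (intro fderiv_works) (simp add: twice_differentiable_def)
  obtain d1 where d1: "0 < d1"
    and A: "\<And>y. norm (y - x) < d1 \<Longrightarrow> norm (fderiv f y v - fderiv f x v - A (y - x)) \<le> \<epsilon> * norm (y - x)"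
    using dA \<epsilon> unfolding has_derivative_at_alt by blast
  obtain d2 where d2: "0 < d2" and f: "\<And>y. dist y x < d2 \<Longrightarrow> f differentiable (at y)"
    using assms unfolding twice_differentiable_def eventually_nhds_metric by blast
  define d where "d = min d1 d2 / K"
  have d: "0 < d" using d1 d2 K by (simp add: d_def)
  interpret A: linear A using dA by (rule has_derivative_linear)
  have "dist ((f (x + t *\<^sub>R v + t *\<^sub>R w) - f (x + t *\<^sub>R v) - f (x + t *\<^sub>R w) + f x) /\<^sub>R t\<^sup>2) (A w) < e"
    if t: "0 < t" "t < d" for t
  proof -
    have tK: "t * K < d1" "t * K < d2"
      using t K by (auto simp: d_def field_simps)
    have near: "norm (s *\<^sub>R v + r *\<^sub>R w) \<le> t * K" if "s \<in> {0..t}" "r \<in> {0..t}" for s r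
    proof -
      have "norm (s *\<^sub>R v + r *\<^sub>R w) \<le> s * norm v + r * norm w"
        using norm_triangle_ineq[of "s *\<^sub>R v" "r *\<^sub>R w"] that by simp
      also have "\<dots> \<le> t * norm v + t * norm w"
        using that by (intro add_mono mult_right_mono) auto
      also have "\<dots> \<le> t * K" using t by (simp add: K_def algebra_simps)
      finally show ?thesis .
    qed
    define p where "p = (\<lambda>r s. x + (s *\<^sub>R v + r *\<^sub>R w))"
    define \<psi> where "\<psi> = (\<lambda>s. f (p t s) - f (p 0 s) - s *\<^sub>R t *\<^sub>R A w)"
    have p: "((\<lambda>s. f (p r s)) has_derivative (\<lambda>h. h *\<^sub>R fderiv f (p r s) v)) (at s within {0..t})"
      if "s \<in> {0..t}" "r \<in> {0..t}" for s r
    proof -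
      have df: "f differentiable (at (p r s))"
        using near[OF that] tK by (intro f) (simp add: p_def dist_norm)
      have "((\<lambda>s. p r s) has_derivative (\<lambda>h. h *\<^sub>R v)) (at s within {0..t})"
        unfolding p_def by (auto intro!: derivative_eq_intros)
      from has_derivative_compose[OF this fderiv_works[OF df]] show ?thesis
        using linear_fderiv[OF df] by (simp add: linear_scale)
    qed
    have "norm (\<psi> t - \<psi> 0) \<le> (\<epsilon> * (t * K) + \<epsilon> * (t * K)) * norm (t - 0)"
    proof (rule differentiable_bound)
      fix s assume s: "s \<in> {0..t}"
      let ?D = "fderiv f (p t s) v - fderiv f (p 0 s) v - t *\<^sub>R A w"
      show "(\<psi> has_derivative (\<lambda>h. h *\<^sub>R ?D)) (at s within {0..t})"
        unfolding \<psi>_def using p[OF s, of t] p[OF s, of 0] t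
        by (auto intro!: derivative_eq_intros simp: scaleR_diff_right)
      have Ap: "norm (fderiv f (p r s) v - fderiv f x v - A (s *\<^sub>R v + r *\<^sub>R w)) \<le> \<epsilon> * (t * K)"
        if "r \<in> {0..t}" for r
      proof -
        have "norm (fderiv f (p r s) v - fderiv f x v - A (p r s - x)) \<le> \<epsilon> * norm (p r s - x)"
          using near[OF s that] tK by (intro A) (simp add: p_def)
        also have "\<dots> \<le> \<epsilon> * (t * K)"
          using near[OF s that] \<epsilon> by (intro mult_left_mono) (auto simp: p_def)
        finally show ?thesis by (simp add: p_def)
      qed
      have D: "?D = (fderiv f (p t s) v - fderiv f x v - A (s *\<^sub>R v + t *\<^sub>R w))
          - (fderiv f (p 0 s) v - fderiv f x v - A (s *\<^sub>R v + 0 *\<^sub>R w))"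
        by (simp add: A.add A.scale)
      have "norm ?D \<le> \<epsilon> * (t * K) + \<epsilon> * (t * K)"
        unfolding D by (rule order_trans[OF norm_triangle_ineq4 add_mono[OF Ap Ap]]) (use t in auto)
      then show "onorm (\<lambda>h. h *\<^sub>R ?D) \<le> \<epsilon> * (t * K) + \<epsilon> * (t * K)"
        by (simp add: onorm_scaleR_left[OF bounded_linear_ident] onorm_id)
    qed (use t in auto)
    then have "norm (\<psi> t - \<psi> 0) \<le> e / 2 * t\<^sup>2"
      using t K by (simp add: \<epsilon>_def power2_eq_square)
    moreover have "\<psi> t - \<psi> 0 = t\<^sup>2 *\<^sub>R
      ((f (x + t *\<^sub>R v + t *\<^sub>R w) - f (x + t *\<^sub>R v) - f (x + t *\<^sub>R w) + f x) /\<^sub>R t\<^sup>2 - A w)"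
      using t by (simp add: \<psi>_def p_def algebra_simps power2_eq_square)
    ultimately have "norm ((f (x + t *\<^sub>R v + t *\<^sub>R w) - f (x + t *\<^sub>R v) - f (x + t *\<^sub>R w) + f x) /\<^sub>R t\<^sup>2 - A w) \<le> e / 2"
      using t by (simp add: mult.commute)
    then show ?thesis using e by (simp add: dist_norm)
  qed
  then show "\<forall>\<^sub>F t in at_right 0. dist ((f (x + t *\<^sub>R v + t *\<^sub>R w) - f (x + t *\<^sub>R v) - f (x + t *\<^sub>R w) + f x) /\<^sub>R t\<^sup>2)
      (fderiv (\<lambda>y. fderiv f y v) x w) < e"
    unfolding A_def[symmetric] using d by (auto simp: eventually_at_right_field)
qed

lemma fderiv_fderiv_commute:
  fixes f :: "'a::real_normed_vector \<Rightarrow> 'b::real_normed_vector"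
  assumes "twice_differentiable f x"
  shows "fderiv (\<lambda>y. fderiv f y v) x w = fderiv (\<lambda>y. fderiv f y w) x v"
proof (rule tendsto_unique[OF _ second_difference_tendsto[OF assms]])
  show "((\<lambda>t. (f (x + t *\<^sub>R v + t *\<^sub>R w) - f (x + t *\<^sub>R v) - f (x + t *\<^sub>R w) + f x) /\<^sub>R t\<^sup>2)
      \<longlongrightarrow> fderiv (\<lambda>y. fderiv f y w) x v) (at_right 0)"
    using second_difference_tendsto[OF assms, of w v] by (simp add: algebra_simps)
qed auto

section \<open>Partial derivatives and the bracket of vector fields\<close>

lemma partial_deriv_eq_fderiv:
  assumes "f differentiable (at x)"
  shows "partial_deriv j f x = fderiv f x (axis j 1)"
proof -
  have "((\<lambda>t :: real. x + t *\<^sub>R axis j 1) has_derivative (\<lambda>h. h *\<^sub>R axis j 1)) (at 0)"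
    by (auto intro!: derivative_eq_intros)
  moreover have "(f has_derivative fderiv f x) (at (x + 0 *\<^sub>R axis j 1))"
    using fderiv_works[OF assms] by simp
  ultimately have "((\<lambda>t. f (x + t *\<^sub>R axis j 1)) has_derivative (\<lambda>h. fderiv f x (h *\<^sub>R axis j 1))) (at 0)"
    by (rule has_derivative_compose)
  then show ?thesis
    unfolding partial_deriv_def using linear_fderiv[OF assms]
    by (intro vector_derivative_at) (simp add: has_vector_derivative_def linear_scale)
qed

lemma linear_eq_sum_axis:
  fixes L :: "real^'n::finite \<Rightarrow> 'b::real_vector"
  assumes "linear L"
  shows "(\<Sum>j\<in>UNIV. (x $ j) *\<^sub>R L (axis j 1)) = L x"
proof -
  have "L x = L (\<Sum>j\<in>UNIV. (x $ j) *\<^sub>R axis j 1)"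
    using basis_expansion[of x] by (simp add: scalar_mult_eq_scaleR)
  then show ?thesis
    using assms by (simp add: linear_sum linear_scale)
qed

lemma vf_bracket_eq_fderiv:
  assumes "X differentiable (at a)" "Z differentiable (at a)"
  shows "vf_bracket X Z a = fderiv X a (Z a) - fderiv Z a (X a)"
  by (simp add: vf_bracket_def sum_subtractf partial_deriv_eq_fderiv assms linear_eq_sum_axis linear_fderiv)

lemma vf_bracket_skew: "vf_bracket Z X a = - vf_bracket X Z a"
  by (simp add: vf_bracket_def sum_negf[symmetric])

lemma vf_bracket_lincomb_left:
  assumes "X differentiable (at a)" "Y differentiable (at a)" "Z differentiable (at a)"
  shows "vf_bracket (\<lambda>b. r *\<^sub>R X b + s *\<^sub>R Y b) Z a = r *\<^sub>R vf_bracket X Z a + s *\<^sub>R vf_bracket Y Z a"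
proof -
  have d: "((\<lambda>b. r *\<^sub>R X b + s *\<^sub>R Y b) has_derivative (\<lambda>h. r *\<^sub>R fderiv X a h + s *\<^sub>R fderiv Y a h)) (at a)"
    by (intro has_derivative_add has_derivative_scaleR_right fderiv_works assms)
  then have "(\<lambda>b. r *\<^sub>R X b + s *\<^sub>R Y b) differentiable (at a)"
    by (auto simp: differentiable_def)
  then show ?thesis
    using assms linear_fderiv[OF assms(3)]
    by (simp add: vf_bracket_eq_fderiv fderiv_eqI[OF d] linear_add linear_scale algebra_simps)
qed

lemma vf_bracket_has_derivative:
  assumes X: "twice_differentiable X a" and Y: "twice_differentiable Y a"
  shows "(vf_bracket X Y has_derivative
     (\<lambda>h. (fderiv (\<lambda>b. fderiv X b (Y a)) a h + fderiv X a (fderiv Y a h))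
        - (fderiv (\<lambda>b. fderiv Y b (X a)) a h + fderiv Y a (fderiv X a h)))) (at a)"
proof -
  note dX = fderiv_works[OF twice_differentiable_imp_differentiable[OF X]]
    and dY = fderiv_works[OF twice_differentiable_imp_differentiable[OF Y]]
  have "((\<lambda>b. fderiv X b (Y b) - fderiv Y b (X b)) has_derivative
     (\<lambda>h. (fderiv (\<lambda>b. fderiv X b (Y a)) a h + fderiv X a (fderiv Y a h))
        - (fderiv (\<lambda>b. fderiv Y b (X a)) a h + fderiv Y a (fderiv X a h)))) (at a)"
    by (intro has_derivative_diff has_derivative_fderiv_apply[OF X] has_derivative_fderiv_apply[OF Y] dX dY)
      auto
  moreover have "\<forall>\<^sub>F b in nhds a. fderiv X b (Y b) - fderiv Y b (X b) = vf_bracket X Y b"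
    using X Y unfolding twice_differentiable_def by (auto elim: eventually_elim2 simp: vf_bracket_eq_fderiv)
  ultimately show ?thesis by (rule has_derivative_eventually_cong)
qed

lemma vf_bracket_differentiable:
  "twice_differentiable X a \<Longrightarrow> twice_differentiable Y a \<Longrightarrow> vf_bracket X Y differentiable (at a)"
  using vf_bracket_has_derivative differentiable_def by blast

text \<open>In the expanded cyclic sum the products of first derivatives cancel in pairs, and the
  second derivatives of each field cancel by symmetry.\<close>

lemma vf_bracket_jacobi:
  assumes X: "twice_differentiable X a" and Y: "twice_differentiable Y a" and Z: "twice_differentiable Z a"
  shows "vf_bracket (vf_bracket X Y) Z a + vf_bracket (vf_bracket Y Z) X a + vf_bracket (vf_bracket Z X) Y a = 0"
proof -
  note d = assms[THEN twice_differentiable_imp_differentiable]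
  have lin: "fderiv X a (u - v) = fderiv X a u - fderiv X a v"
     "fderiv Y a (u - v) = fderiv Y a u - fderiv Y a v"
     "fderiv Z a (u - v) = fderiv Z a u - fderiv Z a v" for u v
    using d[THEN linear_fderiv] by (auto simp: linear_diff)
  show ?thesis
    by (simp add: vf_bracket_eq_fderiv vf_bracket_differentiable assms d lin
        fderiv_eqI[OF vf_bracket_has_derivative[OF X Y]]
        fderiv_eqI[OF vf_bracket_has_derivative[OF Y Z]]
        fderiv_eqI[OF vf_bracket_has_derivative[OF Z X]]
        fderiv_fderiv_commute[OF X, of "Y a" "Z a"]
        fderiv_fderiv_commute[OF Y, of "Z a" "X a"]
        fderiv_fderiv_commute[OF Z, of "X a" "Y a"])
qed

text \<open>The bracket at \<open>a\<close> sees only the germs of the fields at \<open>a\<close>.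
  Hence a relation known pointwise on an open set may be substituted inside an outer
  bracket.\<close>

lemma vf_bracket_cong:
  assumes "X differentiable (at a)" "Z differentiable (at a)"
    and "\<forall>\<^sub>F b in nhds a. X b = X' b" "\<forall>\<^sub>F b in nhds a. Z b = Z' b"
  shows "vf_bracket X' Z' a = vf_bracket X Z a"
proof -
  note X = fderiv_eventually_cong[OF assms(1,3)] and Z = fderiv_eventually_cong[OF assms(2,4)]
  have "X a = X' a" "Z a = Z' a"
    by (rule eventually_nhds_x_imp_x[OF assms(3)], rule eventually_nhds_x_imp_x[OF assms(4)])
  then show ?thesis
    by (simp only: vf_bracket_eq_fderiv[OF assms(1,2)] vf_bracket_eq_fderiv[OF X(1) Z(1)] X(2) Z(2))
qed

lemma vf_bracket_lincomb_right:
  assumes "X differentiable (at a)" "Y differentiable (at a)" "Z differentiable (at a)"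
  shows "vf_bracket Z (\<lambda>b. r *\<^sub>R X b + s *\<^sub>R Y b) a = r *\<^sub>R vf_bracket Z X a + s *\<^sub>R vf_bracket Z Y a"
  using arg_cong[OF vf_bracket_lincomb_left[OF assms, of r s], of uminus]
  by (simp add: vf_bracket_skew[of _ Z] minus_diff_eq)

lemma vf_bracket_neg_sum_right:
  assumes "X differentiable (at a)" "Y differentiable (at a)" "Z differentiable (at a)"
  shows "vf_bracket Z (\<lambda>b. - X b - Y b) a = - vf_bracket Z X a - vf_bracket Z Y a"
  using vf_bracket_lincomb_right[OF assms, of "-1" "-1"] by simp

lemma vf_bracket_neg_sum_left:
  assumes "X differentiable (at a)" "Y differentiable (at a)" "Z differentiable (at a)"
  shows "vf_bracket (\<lambda>b. - X b - Y b) Z a = - vf_bracket X Z a - vf_bracket Y Z a"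
  using vf_bracket_lincomb_left[OF assms, of "-1" "-1"] by simp

section \<open>Differentiability classes under change of germ representative and linear
  substitution\<close>

lemma twice_differentiable_cong:
  assumes "twice_differentiable f x" "\<forall>\<^sub>F y in nhds x. f y = g y"
  shows "twice_differentiable g x"
proof -
  have "\<forall>\<^sub>F y in nhds x. \<forall>\<^sub>F z in nhds y. f z = g z"
    using assms(2) by (simp add: eventually_eventually)
  moreover have "\<forall>\<^sub>F y in nhds x. f differentiable (at y)"
    using assms(1) by (simp add: twice_differentiable_def)
  ultimately have *: "\<forall>\<^sub>F y in nhds x. g differentiable (at y) \<and> fderiv g y = fderiv f y"
    by eventually_elim (metis fderiv_eventually_cong)
  have "(\<lambda>y. fderiv g y v) differentiable (at x)" for v
  proof (rule fderiv_eventually_cong(1))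
    show "(\<lambda>y. fderiv f y v) differentiable (at x)"
      using assms(1) by (simp add: twice_differentiable_def)
    show "\<forall>\<^sub>F y in nhds x. fderiv f y v = fderiv g y v"
      using * by (rule eventually_mono) simp
  qed
  then show ?thesis
    using * by (auto simp: twice_differentiable_def elim: eventually_mono)
qed

lemma
  assumes "bounded_linear L" "f differentiable (at (L x))"
  shows differentiable_compose_linear: "(\<lambda>x. f (L x)) differentiable (at x)"
    and fderiv_compose_linear: "fderiv (\<lambda>x. f (L x)) x v = fderiv f (L x) (L v)"
proof -
  have "((\<lambda>x. f (L x)) has_derivative (\<lambda>v. fderiv f (L x) (L v))) (at x)"
    by (rule has_derivative_compose[OF bounded_linear_imp_has_derivative[OF assms(1)] fderiv_works[OF assms(2)]])
  then show "(\<lambda>x. f (L x)) differentiable (at x)" "fderiv (\<lambda>x. f (L x)) x v = fderiv f (L x) (L v)"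
    by (auto simp: differentiable_def fderiv_eqI)
qed

lemma eventually_compose_linear:
  assumes "bounded_linear L" "\<forall>\<^sub>F y in nhds (L x). P y"
  shows "\<forall>\<^sub>F x in nhds x. P (L x)"
  using linear_continuous_at[OF assms(1), of x]
  by (intro eventually_compose_filterlim[OF assms(2)]) (simp add: continuous_at tendsto_at_iff_tendsto_nhds)

lemma twice_differentiable_compose_linear:
  assumes L: "bounded_linear L" and f: "twice_differentiable f (L x)"
  shows "twice_differentiable (\<lambda>x. f (L x)) x"
proof -
  have ev: "\<forall>\<^sub>F y in nhds x. f differentiable (at (L y))"
    by (rule eventually_compose_linear[OF L]) (use f in \<open>simp add: twice_differentiable_def\<close>)
  have "(\<lambda>y. fderiv (\<lambda>x. f (L x)) y v) differentiable (at x)" for v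
  proof (rule fderiv_eventually_cong(1))
    show "(\<lambda>y. fderiv f (L y) (L v)) differentiable (at x)"
      by (rule differentiable_compose_linear[OF L, where f = "\<lambda>y. fderiv f y (L v)"])
        (use f in \<open>simp add: twice_differentiable_def\<close>)
    show "\<forall>\<^sub>F y in nhds x. fderiv f (L y) (L v) = fderiv (\<lambda>x. f (L x)) y v"
      using ev by (rule eventually_mono) (simp add: fderiv_compose_linear[OF L])
  qed
  moreover have "\<forall>\<^sub>F y in nhds x. (\<lambda>x. f (L x)) differentiable (at y)"
    using ev by (rule eventually_mono) (rule differentiable_compose_linear[OF L])
  ultimately show ?thesis by (simp add: twice_differentiable_def)
qed

text \<open>Three orders are consumed: one in passing from a family of transformations to its vector
  fields, two in the Jacobi identity for these fields.\<close>

definition thrice_differentiable ::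
    "('a::real_normed_vector \<Rightarrow> 'b::real_normed_vector) \<Rightarrow> 'a \<Rightarrow> bool" where
  "thrice_differentiable f x \<longleftrightarrow>
     twice_differentiable f x \<and> (\<forall>v. twice_differentiable (\<lambda>y. fderiv f y v) x)"

lemma thrice_differentiable_compose_linear:
  assumes L: "bounded_linear L" and f: "thrice_differentiable f (L x)"
  shows "thrice_differentiable (\<lambda>x. f (L x)) x"
proof -
  have "\<forall>\<^sub>F y in nhds (L x). f differentiable (at y)"
    using f by (simp add: thrice_differentiable_def twice_differentiable_def)
  then have "\<forall>\<^sub>F y in nhds x. f differentiable (at (L y))"
    by (rule eventually_compose_linear[OF L])
  then have ev: "\<forall>\<^sub>F y in nhds x. fderiv f (L y) (L v) = fderiv (\<lambda>x. f (L x)) y v" for v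
    by (rule eventually_mono) (simp add: fderiv_compose_linear[OF L])
  have "twice_differentiable (\<lambda>y. fderiv f (L y) (L v)) x" for v
    by (rule twice_differentiable_compose_linear[OF L, where f = "\<lambda>y. fderiv f y (L v)"])
      (use f in \<open>simp add: thrice_differentiable_def\<close>)
  then have "twice_differentiable (\<lambda>y. fderiv (\<lambda>x. f (L x)) y v) x" for v
    by (rule twice_differentiable_cong) (rule ev)
  then show ?thesis
    using f by (auto simp: thrice_differentiable_def intro: twice_differentiable_compose_linear[OF L])
qed

lemma real_analytic_on_imp_thrice_differentiable:
  assumes "real_analytic_on f N" "open N" "x \<in> N"
  shows "thrice_differentiable f x"
proof -
  have "real_analytic_on (\<lambda>y. fderiv f y v) N" for v
    using assms(1) unfolding real_analytic_on_def by (blast intro: real_analytic_at_frechet_derivative)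
  then show ?thesis
    using assms by (auto simp: thrice_differentiable_def intro: real_analytic_on_imp_twice_differentiable)
qed


subsection \<open>The Lie algebra of infinitesimal Moufang transformations\<close>

definition six_yamagutian ::
    "('v \<Rightarrow> real^'m \<Rightarrow> real^'m) \<Rightarrow> ('v \<Rightarrow> real^'m \<Rightarrow> real^'m::finite) \<Rightarrow> 'v \<Rightarrow> 'v \<Rightarrow> real^'m \<Rightarrow> real^'m" where
  "six_yamagutian S T x y b = vf_bracket (S x) (S y) b + vf_bracket (T x) (T y) b
     + vf_bracket (\<lambda>b. - S x b - T x b) (\<lambda>b. - S y b - T y b) b"

text \<open>Separates the commutation relations from their origin, so that one computation serves
  the given action and the translations of the loop. They are required on an open set and not at one
  point because they are bracketed with a third field.\<close>

locale triality_fields =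
  fixes S T :: "'v::real_vector \<Rightarrow> real^'m \<Rightarrow> real^'m::finite"
    and V :: "(real^'m) set"
    and br :: "'v \<Rightarrow> 'v \<Rightarrow> 'v"
  assumes V: "open V"
    and S2: "b \<in> V \<Longrightarrow> twice_differentiable (S x) b"
    and T2: "b \<in> V \<Longrightarrow> twice_differentiable (T x) b"
    and S_linear: "b \<in> V \<Longrightarrow> linear (\<lambda>x. S x b)"
    and T_linear: "b \<in> V \<Longrightarrow> linear (\<lambda>x. T x b)"
    and SS: "b \<in> V \<Longrightarrow> vf_bracket (S x) (S y) b = S (br x y) b - 2 *\<^sub>R vf_bracket (S x) (T y) b"
    and TT: "b \<in> V \<Longrightarrow> vf_bracket (T x) (T y) b = - T (br x y) b - 2 *\<^sub>R vf_bracket (S x) (T y) b"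
    and ST: "b \<in> V \<Longrightarrow> vf_bracket (S x) (T y) b = - vf_bracket (S y) (T x) b"
begin

lemma S1: "b \<in> V \<Longrightarrow> S x differentiable (at b)"
  and T1: "b \<in> V \<Longrightarrow> T x differentiable (at b)"
  using S2 T2 twice_differentiable_imp_differentiable by blast+

lemma eventually_V: "b \<in> V \<Longrightarrow> (\<And>c. c \<in> V \<Longrightarrow> P c) \<Longrightarrow> \<forall>\<^sub>F c in nhds b. P c"
  using V by (metis (mono_tags, lifting) eventually_nhds)

lemma bracket_ST_differentiable: "b \<in> V \<Longrightarrow> vf_bracket (S x) (T y) differentiable (at b)"
  by (simp add: vf_bracket_differentiable S2 T2)

lemma TS: "b \<in> V \<Longrightarrow> vf_bracket (T x) (S y) b = vf_bracket (S x) (T y) b"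
  using ST[of b x y] vf_bracket_skew[of "T x" "S y" b] by simp

lemma bracket_SS:
  assumes "b \<in> V" "Z differentiable (at b)"
  shows "vf_bracket (vf_bracket (S x) (S y)) Z b
     =  vf_bracket (S (br x y)) Z b - 2 *\<^sub>R vf_bracket (vf_bracket (S x) (T y)) Z b"
proof -
  have "vf_bracket (vf_bracket (S x) (S y)) Z b
      = vf_bracket (\<lambda>b. 1 *\<^sub>R S (br x y) b + (-2) *\<^sub>R vf_bracket (S x) (T y) b) Z b"
    by (rule vf_bracket_cong[symmetric])
      (auto intro!: vf_bracket_differentiable assms S2 eventually_V[OF assms(1)] simp: SS)
  also have "\<dots> =  vf_bracket (S (br x y)) Z b - 2 *\<^sub>R vf_bracket (vf_bracket (S x) (T y)) Z b"
    by (subst vf_bracket_lincomb_left) (auto intro: assms S1 bracket_ST_differentiable)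
  finally show ?thesis .
qed

lemma bracket_TT:
  assumes "b \<in> V" "Z differentiable (at b)"
  shows "vf_bracket (vf_bracket (T x) (T y)) Z b
     = - vf_bracket (T (br x y)) Z b - 2 *\<^sub>R vf_bracket (vf_bracket (S x) (T y)) Z b"
proof -
  have "vf_bracket (vf_bracket (T x) (T y)) Z b
      = vf_bracket (\<lambda>b. (-1) *\<^sub>R T (br x y) b + (-2) *\<^sub>R vf_bracket (S x) (T y) b) Z b"
    by (rule vf_bracket_cong[symmetric])
      (auto intro!: vf_bracket_differentiable assms T2 eventually_V[OF assms(1)] simp: TT)
  also have "\<dots> = - vf_bracket (T (br x y)) Z b - 2 *\<^sub>R vf_bracket (vf_bracket (S x) (T y)) Z b"
    by (subst vf_bracket_lincomb_left) (auto intro: assms T1 bracket_ST_differentiable)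
  finally show ?thesis .
qed

lemma bracket_TS:
  assumes "b \<in> V" "Z differentiable (at b)"
  shows "vf_bracket (vf_bracket (T x) (S y)) Z b = vf_bracket (vf_bracket (S x) (T y)) Z b"
  by (rule vf_bracket_cong) (auto intro!: bracket_ST_differentiable assms eventually_V[OF assms(1)] simp: TS)

text \<open>The Jacobi identities of the triples of types SST, TTS, SSS and TTT form a linear system
  that determines the brackets with \<open>[S\<^sub>x, T\<^sub>y]\<close>.\<close>

lemma bracket_ST_S_T:
  fixes x y z
  assumes b: "b \<in> V"
  defines "J \<equiv> br (br x y) z + br (br y z) x + br (br z x) y"
  shows "6 *\<^sub>R vf_bracket (vf_bracket (S x) (T y)) (S z) b = S J b - 6 *\<^sub>R vf_bracket (S (br x y)) (T z) b"
    and "6 *\<^sub>R vf_bracket (vf_bracket (S x) (T y)) (T z) b = T J b + 6 *\<^sub>R vf_bracket (S (br x y)) (T z) b"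
proof -
  note d = S1[OF b] T1[OF b]
  define s where "s = (\<lambda>x y z. vf_bracket (vf_bracket (S x) (T y)) (S z) b)"
  define t where "t = (\<lambda>x y z. vf_bracket (vf_bracket (S x) (T y)) (T z) b)"
  define D where "D = (\<lambda>x y. vf_bracket (S x) (T y) b)"
  have SST: "D (br x y) z - 2 *\<^sub>R t x y z + s y z x + s z x y = 0" for x y z
    using vf_bracket_jacobi[OF S2[OF b] S2[OF b] T2[OF b], of x y z]
    by (simp add: bracket_SS[OF b] bracket_TS[OF b] d s_def t_def D_def)
  have TSD: "vf_bracket (T x) (S y) b = D x y" for x y
    using TS[OF b] by (simp add: D_def)
  have TTS: "- D (br x y) z - 2 *\<^sub>R s x y z + t y z x + t z x y = 0" for x y z
    using vf_bracket_jacobi[OF T2[OF b] T2[OF b] S2[OF b], of x y z]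
    by (simp add: bracket_TT[OF b] bracket_TS[OF b] d TSD)
      (simp add: s_def t_def)
  have S_J: "S J b = S (br (br x y) z) b + S (br (br y z) x) b + S (br (br z x) y) b"
    and T_J: "T J b = T (br (br x y) z) b + T (br (br y z) x) b + T (br (br z x) y) b"
    by (simp_all add: J_def linear_add[OF S_linear[OF b]] linear_add[OF T_linear[OF b]])
  have SSS: "S J b - 2 *\<^sub>R (D (br x y) z + D (br y z) x + D (br z x) y)
      - 2 *\<^sub>R (s x y z + s y z x + s z x y) = 0"
    using vf_bracket_jacobi[OF S2[OF b] S2[OF b] S2[OF b], of x y z]
    by (simp add: bracket_SS[OF b] d SS[OF b] S_J s_def D_def algebra_simps)
  have TTT: "T J b + 2 *\<^sub>R (D (br x y) z + D (br y z) x + D (br z x) y)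
      - 2 *\<^sub>R (t x y z + t y z x + t z x y) = 0"
    using vf_bracket_jacobi[OF T2[OF b] T2[OF b] T2[OF b], of x y z]
    by (simp add: bracket_TT[OF b] d TT[OF b] T_J t_def D_def algebra_simps)
  \<comment> \<open>With \<open>\<sigma>\<close> and \<open>\<tau>\<close> the cyclic sums of
    \<open>s\<close> and \<open>t\<close>, SST reads \<open>s + 2 t = D + \<sigma>\<close> and TTS
    reads \<open>2 s + t = \<tau> - D\<close>, while SSS and TTT express \<open>\<sigma>\<close> and
    \<open>\<tau>\<close> by \<open>S J\<close>, \<open>T J\<close> and the cyclic sum of
    \<open>D\<close>. Adding the three SST equations shows that \<open>S J - T J\<close> is three
    times that cyclic sum, which eliminates it.\<close>
  note comp = SST[of x y z] SST[of y z x] SST[of z x y] TTS[of x y z] TTS[of y z x] TTS[of z x y] SSS TTT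
  have "6 *\<^sub>R s x y z = S J b - 6 *\<^sub>R D (br x y) z \<and> 6 *\<^sub>R t x y z = T J b + 6 *\<^sub>R D (br x y) z"
    using comp unfolding vec_eq_iff by (simp add: algebra_simps) smt
  then show "6 *\<^sub>R vf_bracket (vf_bracket (S x) (T y)) (S z) b = S J b - 6 *\<^sub>R vf_bracket (S (br x y)) (T z) b"
    "6 *\<^sub>R vf_bracket (vf_bracket (S x) (T y)) (T z) b = T J b + 6 *\<^sub>R vf_bracket (S (br x y)) (T z) b"
    by (simp_all add: s_def t_def D_def)
qed

text \<open>By \<open>TS\<close>, the bracket of the \<open>P\<close> fields is the sum of the
  \<open>S\<close> bracket, the \<open>T\<close> bracket and \<open>2 D\<close>. The total is twice
  the first two plus \<open>2 D\<close>, so \<open>D\<close> gets the coefficient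
  \<open>-8 + 2\<close>.\<close>

lemma six_yamagutian_eq:
  assumes b: "b \<in> V"
  shows "six_yamagutian S T x y b = 2 *\<^sub>R S (br x y) b - 2 *\<^sub>R T (br x y) b - 6 *\<^sub>R vf_bracket (S x) (T y) b"
proof -
  note d = S1[OF b] T1[OF b]
  have dP: "(\<lambda>b. - S x b - T x b) differentiable (at b)" for x
    by (intro differentiable_diff differentiable_minus d)
  show ?thesis
    by (simp add: six_yamagutian_def vf_bracket_neg_sum_left vf_bracket_neg_sum_right d dP SS[OF b] TT[OF b] TS[OF b]
        vec_eq_iff algebra_simps)
qed

lemma six_yamagutian_differentiable:
  assumes b: "b \<in> V"
  shows "six_yamagutian S T x y differentiable (at b)"
proof -
  have "(\<lambda>b. 2 *\<^sub>R S (br x y) b - 2 *\<^sub>R T (br x y) b - 6 *\<^sub>R vf_bracket (S x) (T y) b) differentiable (at b)"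
    by (intro differentiable_diff differentiable_scaleR differentiable_const S1 T1 bracket_ST_differentiable b)
  then show ?thesis
    by (rule fderiv_eventually_cong(1)) (auto intro!: eventually_V[OF b] simp: six_yamagutian_eq)
qed

lemma bracket_six_yamagutian:
  assumes b: "b \<in> V" and Z: "Z differentiable (at b)"
  shows "vf_bracket (six_yamagutian S T x y) Z b = 2 *\<^sub>R vf_bracket (S (br x y)) Z b
    - 2 *\<^sub>R vf_bracket (T (br x y)) Z b - 6 *\<^sub>R vf_bracket (vf_bracket (S x) (T y)) Z b"
proof -
  note d = S1[OF b] T1[OF b] bracket_ST_differentiable[OF b]
  define X where "X = (\<lambda>b. 2 *\<^sub>R S (br x y) b + (-2) *\<^sub>R T (br x y) b)"
  have dX: "X differentiable (at b)"
    unfolding X_def by (intro differentiable_add differentiable_scaleR differentiable_const d)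
  have "vf_bracket (six_yamagutian S T x y) Z b
      = vf_bracket (\<lambda>b. 1 *\<^sub>R X b + (-6) *\<^sub>R vf_bracket (S x) (T y) b) Z b"
    by (rule vf_bracket_cong[symmetric, OF six_yamagutian_differentiable[OF b] Z])
      (auto intro!: eventually_V[OF b] simp: six_yamagutian_eq X_def)
  also have "\<dots> = vf_bracket X Z b - 6 *\<^sub>R vf_bracket (vf_bracket (S x) (T y)) Z b"
    by (subst vf_bracket_lincomb_left) (auto intro: dX d Z)
  also have "vf_bracket X Z b = 2 *\<^sub>R vf_bracket (S (br x y)) Z b - 2 *\<^sub>R vf_bracket (T (br x y)) Z b"
    unfolding X_def by (subst vf_bracket_lincomb_left) (auto intro: d Z)
  finally show ?thesis .
qed

text \<open>Isolates the Jacobian, the combination in which the Jacobi identities deliver their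
  result.\<close>

lemma triple_bracket_eq:
  "br (br x y) z - br (br y z) x - br (br z x) y
     = 2 *\<^sub>R br (br x y) z - (br (br x y) z + br (br y z) x + br (br z x) y)"
  by (simp add: scaleR_2)

text \<open>The multiples of \<open>vf_bracket (S (br x y)) (T z)\<close> cancel: against
  \<open>S z\<close> they are -4, -2 and 6, against \<open>T z\<close> they are 2, 4 and -6. Twice
  the double bracket minus the Jacobian is left.\<close>

lemma bracket_six_yamagutian_S_T:
  assumes b: "b \<in> V"
  shows "vf_bracket (six_yamagutian S T x y) (S z) b
      = S (br (br x y) z - br (br y z) x - br (br z x) y) b"
    and "vf_bracket (six_yamagutian S T x y) (T z) b
      = T (br (br x y) z - br (br y z) x - br (br z x) y) b"
  unfolding triple_bracket_eq linear_diff[OF S_linear[OF b]] linear_scale[OF S_linear[OF b]]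
    linear_diff[OF T_linear[OF b]] linear_scale[OF T_linear[OF b]]
  using bracket_ST_S_T[OF b, of x y z]
  by (simp_all add: bracket_six_yamagutian[OF b] S1[OF b] T1[OF b] SS[OF b] TT[OF b] TS[OF b] vec_eq_iff algebra_simps)

end


subsection \<open>Second-order consequences of the action identities\<close>

text \<open>One map of the pair (parameter, point), so that parameter and space derivatives are
  parts of a single derivative. Values may leave \<open>V\<close>; before a second map is applied,
  \<open>local_family_eventually_in\<close> provides membership for small parameters.\<close>

definition local_family ::
    "((real^'n::finite) \<times> (real^'m::finite) \<Rightarrow> real^'m) \<Rightarrow> (real^'n) set \<Rightarrow> (real^'m) set \<Rightarrow> bool" where
  "local_family F N V \<longleftrightarrow> open N \<and> 0 \<in> N \<and> open V \<and>
     (\<forall>p\<in>N \<times> V. thrice_differentiable F p) \<and> (\<forall>a\<in>V. F (0, a) = a)"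

definition generator ::
    "((real^'n::finite) \<times> (real^'m::finite) \<Rightarrow> real^'m) \<Rightarrow> real^'n \<Rightarrow> real^'m \<Rightarrow> real^'m" where
  "generator F x a = fderiv F (0, a) (x, 0)"

lemma bounded_linear_Pair_zero: "bounded_linear (\<lambda>a. (0, a))" "bounded_linear (\<lambda>g. (g, 0))"
  by (auto intro!: bounded_linear_Pair bounded_linear_zero bounded_linear_ident)

context
  fixes F :: "(real^'n::finite) \<times> (real^'m::finite) \<Rightarrow> real^'m" and N V
  assumes F: "local_family F N V"
begin

lemma local_family_thrice: "g \<in> N \<Longrightarrow> a \<in> V \<Longrightarrow> thrice_differentiable F (g, a)"
  using F by (simp add: local_family_def)

lemma local_family_twice: "g \<in> N \<Longrightarrow> a \<in> V \<Longrightarrow> twice_differentiable F (g, a)"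
  using local_family_thrice by (simp add: thrice_differentiable_def)

lemma local_family_differentiable: "g \<in> N \<Longrightarrow> a \<in> V \<Longrightarrow> F differentiable (at (g, a))"
  using local_family_twice twice_differentiable_imp_differentiable by blast

lemma local_family_zero: "0 \<in> N" using F by (simp add: local_family_def)

lemma local_family_eventually: "a \<in> V \<Longrightarrow> \<forall>\<^sub>F b in nhds a. b \<in> V"
  using F by (simp add: local_family_def eventually_nhds_in_open)

lemma local_family_eventually_param: "\<forall>\<^sub>F g in nhds 0. g \<in> N"
  using F by (simp add: local_family_def eventually_nhds_in_open)

lemma fderiv_local_family_snd:
  assumes a: "a \<in> V"
  shows "fderiv F (0, a) (0, v) = v"
proof -
  have "((\<lambda>b. b) has_derivative (\<lambda>v. v)) (at a)" by simp
  moreover have "\<forall>\<^sub>F b in nhds a. b = F (0, b)"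
    using local_family_eventually[OF a] by (rule eventually_mono) (use F in \<open>simp add: local_family_def\<close>)
  ultimately have "((\<lambda>b. F (0, b)) has_derivative (\<lambda>v. v)) (at a)"
    by (rule has_derivative_eventually_cong)
  then show ?thesis
    using fderiv_compose_linear[OF bounded_linear_Pair_zero(1) local_family_differentiable[OF local_family_zero a], of v]
    by (simp add: fderiv_eqI)
qed

lemma fderiv_local_family:
  assumes a: "a \<in> V"
  shows "fderiv F (0, a) (x, v) = generator F x a + v"
proof -
  have "fderiv F (0, a) ((x, 0) + (0, v)) = fderiv F (0, a) (x, 0) + fderiv F (0, a) (0, v)"
    by (intro linear_add linear_fderiv local_family_differentiable local_family_zero a)
  then show ?thesis by (simp add: generator_def fderiv_local_family_snd[OF a])
qed

lemma generator_linear: "a \<in> V \<Longrightarrow> linear (\<lambda>x. generator F x a)"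
  unfolding generator_def
  using linear_compose[OF bounded_linear.linear[OF bounded_linear_Pair_zero(2)]
      linear_fderiv[OF local_family_differentiable[OF local_family_zero]]]
  by (simp add: o_def)

lemma local_family_fderiv_differentiable:
  "g \<in> N \<Longrightarrow> a \<in> V \<Longrightarrow> (\<lambda>p. fderiv F p v) differentiable (at (g, a))"
  using local_family_twice unfolding twice_differentiable_def by blast

lemma fderiv2_local_family_split:
  assumes a: "a \<in> V"
  shows "fderiv (\<lambda>p. fderiv F p v) (0, a) (x, w)
     = fderiv (\<lambda>p. fderiv F p v) (0, a) (x, 0) + fderiv (\<lambda>p. fderiv F p v) (0, a) (0, w)"
proof -
  have "fderiv (\<lambda>p. fderiv F p v) (0, a) ((x, 0) + (0, w))
     = fderiv (\<lambda>p. fderiv F p v) (0, a) (x, 0) + fderiv (\<lambda>p. fderiv F p v) (0, a) (0, w)"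
    by (intro linear_add linear_fderiv local_family_fderiv_differentiable local_family_zero a)
  then show ?thesis by simp
qed

text \<open>At parameter 0 the map is the identity on all of \<open>V\<close>, so its space
  derivative is constant there. Of the second derivative only the pure parameter part and the mixed
  part survive, and the latter is the derivative of a generator.\<close>

lemma fderiv2_local_family_snd:
  assumes a: "a \<in> V"
  shows "fderiv (\<lambda>p. fderiv F p (0, v)) (0, a) (0, w) = 0"
proof -
  have "((\<lambda>b. v) has_derivative (\<lambda>w. 0)) (at a)" by simp
  moreover have "\<forall>\<^sub>F b in nhds a. v = fderiv F (0, b) (0, v)"
    using local_family_eventually[OF a] by (rule eventually_mono) (simp add: fderiv_local_family_snd)
  ultimately have "((\<lambda>b. fderiv F (0, b) (0, v)) has_derivative (\<lambda>w. 0)) (at a)"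
    by (rule has_derivative_eventually_cong)
  then show ?thesis
    using fderiv_compose_linear[OF bounded_linear_Pair_zero(1)
        local_family_fderiv_differentiable[OF local_family_zero a, of "(0, v)"], of w]
    by (simp add: fderiv_eqI)
qed

lemma fderiv_generator:
  "a \<in> V \<Longrightarrow> fderiv (generator F x) a w = fderiv (\<lambda>p. fderiv F p (x, 0)) (0, a) (0, w)"
  using fderiv_compose_linear[OF bounded_linear_Pair_zero(1)
      local_family_fderiv_differentiable[OF local_family_zero, of a "(x, 0)"], of w]
  by (simp add: generator_def[abs_def])

lemma fderiv2_local_family_mixed:
  "a \<in> V \<Longrightarrow> fderiv (\<lambda>p. fderiv F p (0, w)) (0, a) (x, 0) = fderiv (generator F x) a w"
  by (simp add: fderiv_generator fderiv_fderiv_commute[OF local_family_twice[OF local_family_zero], of a "(0, w)"])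

lemma generator_twice_differentiable:
  assumes "a \<in> V"
  shows "twice_differentiable (generator F x) a"
proof -
  have "twice_differentiable (\<lambda>p. fderiv F p (x, 0)) (0, a)"
    using local_family_thrice[OF local_family_zero assms] by (simp add: thrice_differentiable_def)
  then show ?thesis
    using twice_differentiable_compose_linear[OF bounded_linear_Pair_zero(1), of "\<lambda>p. fderiv F p (x, 0)" a]
    by (simp add: generator_def[abs_def])
qed

lemma local_family_param_has_derivative:
  assumes g: "g \<in> N" and a: "a \<in> V"
  shows "((\<lambda>g. F (g, a)) has_derivative (\<lambda>x. fderiv F (g, a) (x, 0))) (at g)"
proof -
  have "((\<lambda>g. (g, a)) has_derivative (\<lambda>x. (x, 0))) (at g)"
    by (auto intro!: derivative_eq_intros)
  from has_derivative_compose[OF this fderiv_works[OF local_family_differentiable[OF g a]]]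
  show ?thesis .
qed

lemma local_family_param_has_derivative_0:
  "a \<in> V \<Longrightarrow> ((\<lambda>g. F (g, a)) has_derivative (\<lambda>x. generator F x a)) (at 0)"
  using local_family_param_has_derivative[OF local_family_zero] by (simp add: generator_def)

lemma local_family_eventually_in:
  assumes a: "a \<in> V"
  shows "\<forall>\<^sub>F g in nhds 0. F (g, a) \<in> V"
proof -
  have "isCont (\<lambda>g. F (g, a)) 0"
    using local_family_param_has_derivative_0[OF a] by (rule has_derivative_continuous)
  moreover have "F (0, a) = a" using F a by (simp add: local_family_def)
  ultimately have "filterlim (\<lambda>g. F (g, a)) (nhds a) (nhds 0)"
    using tendsto_at_iff_tendsto_nhds[of "\<lambda>g. F (g, a)" 0] by (simp add: continuous_at)
  then show ?thesis
    by (rule eventually_compose_filterlim[OF local_family_eventually[OF a]])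
qed

end

text \<open>A common template: \<open>H\<close>, \<open>K\<close> are \<open>S\<close>,
  \<open>T\<close> with the loop product for one action identity, and \<open>T\<close>,
  \<open>S\<close> with the opposite product for the other. Only \<open>h\<close> is differentiated,
  so the result holds at every small \<open>g\<close> and can be differentiated again.\<close>

lemma action_first_order:
  fixes F G H K :: "(real^'n::finite) \<times> (real^'m::finite) \<Rightarrow> real^'m"
    and \<mu> :: "(real^'n) \<times> (real^'n) \<Rightarrow> real^'n"
  assumes F: "local_family F N V" and G: "local_family G N V"
    and H: "local_family H N V" and K: "local_family K N V"
    and \<mu>: "\<mu> differentiable (at (g, 0))" and unit: "\<mu> (g, 0) = g"
    and eq: "\<And>h. h \<in> N \<Longrightarrow> F (g, G (g, H (h, a))) = H (\<mu> (g, h), K (g, a))"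
    and g: "g \<in> N" and a: "a \<in> V" and Ga: "G (g, a) \<in> V" and Ka: "K (g, a) \<in> V"
  shows "fderiv F (g, G (g, a)) (0, fderiv G (g, a) (0, generator H y a))
    = fderiv H (g, K (g, a)) (fderiv \<mu> (g, 0) (0, y), 0)"
proof -
  have H0: "H (0, a) = a" using H a by (simp add: local_family_def)
  note dH = local_family_param_has_derivative_0[OF H a]
  have dG: "((\<lambda>h. G (g, H (h, a))) has_derivative (\<lambda>y. fderiv G (g, a) (0, generator H y a))) (at 0)"
    using has_derivative_compose[OF has_derivative_Pair[OF has_derivative_const dH],
        of G "fderiv G (g, a)" g] fderiv_works[OF local_family_differentiable[OF G g a]]
    by (simp add: H0)
  have dF: "((\<lambda>h. F (g, G (g, H (h, a)))) has_derivative
      (\<lambda>y. fderiv F (g, G (g, a)) (0, fderiv G (g, a) (0, generator H y a)))) (at 0)"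
    using has_derivative_compose[OF has_derivative_Pair[OF has_derivative_const dG],
        of F "fderiv F (g, G (g, a))" g] fderiv_works[OF local_family_differentiable[OF F g Ga]]
    by (simp add: H0)
  have d\<mu>: "((\<lambda>h. \<mu> (g, h)) has_derivative (\<lambda>y. fderiv \<mu> (g, 0) (0, y))) (at 0)"
    by (rule has_derivative_compose[OF has_derivative_Pair[OF has_derivative_const has_derivative_ident] fderiv_works[OF \<mu>]])
  have "((\<lambda>h. H (\<mu> (g, h), K (g, a))) has_derivative
      (\<lambda>y. fderiv H (g, K (g, a)) (fderiv \<mu> (g, 0) (0, y), 0))) (at 0)"
    using has_derivative_compose[OF has_derivative_Pair[OF d\<mu> has_derivative_const],
        of H "fderiv H (g, K (g, a))" "K (g, a)"] fderiv_works[OF local_family_differentiable[OF H g Ka]]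
    by (simp add: unit)
  then have "((\<lambda>h. F (g, G (g, H (h, a)))) has_derivative
      (\<lambda>y. fderiv H (g, K (g, a)) (fderiv \<mu> (g, 0) (0, y), 0))) (at 0)"
    by (rule has_derivative_eventually_cong)
      (use local_family_eventually_param[OF F] eq in \<open>auto elim: eventually_mono\<close>)
  from has_derivative_unique[OF dF this] show ?thesis by meson
qed

text \<open>Derivative of the first-order identity at \<open>g = 0\<close>. The pure parameter
  derivative of \<open>H\<close> is kept as a term, since it is symmetric in \<open>x\<close> and
  \<open>y\<close> and will drop out when the two orders are compared.\<close>

lemma action_second_order:
  fixes F G H K :: "(real^'n::finite) \<times> (real^'m::finite) \<Rightarrow> real^'m"
    and \<mu> :: "(real^'n) \<times> (real^'n) \<Rightarrow> real^'n"
  assumes F: "local_family F N V" and G: "local_family G N V"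
    and H: "local_family H N V" and K: "local_family K N V"
    and \<mu>: "\<And>g. g \<in> N \<Longrightarrow> twice_differentiable \<mu> (g, 0)"
    and unit: "\<And>g. g \<in> N \<Longrightarrow> \<mu> (g, 0) = g" "\<And>g. g \<in> N \<Longrightarrow> \<mu> (0, g) = g"
    and eq: "\<And>g h. g \<in> N \<Longrightarrow> h \<in> N \<Longrightarrow> F (g, G (g, H (h, a))) = H (\<mu> (g, h), K (g, a))"
    and a: "a \<in> V"
  shows "fderiv (generator F x) a (generator H y a) + fderiv (generator G x) a (generator H y a)
    = fderiv (\<lambda>p. fderiv H p (y, 0)) (0, a) (x, 0) + fderiv (generator H y) a (generator K x a)
      + generator H (fderiv (\<lambda>p. fderiv \<mu> p (0, y)) (0, 0) (x, 0)) a"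
proof -
  note N0 = local_family_zero[OF F]
  note F2 = local_family_twice[OF F N0 a] and G2 = local_family_twice[OF G N0 a]
    and H2 = local_family_twice[OF H N0 a] and M2 = \<mu>[OF N0]
  let ?Hy = "generator H y a"
  have G0: "G (0, a) = a" and K0: "K (0, a) = a"
    using G K a by (auto simp: local_family_def)
  have M0: "fderiv \<mu> (0, 0) (0, y) = y"
  proof -
    have "((\<lambda>h. \<mu> (0, h)) has_derivative (\<lambda>y. y)) (at 0)"
      by (rule has_derivative_eventually_cong[OF has_derivative_ident])
        (use local_family_eventually_param[OF F] unit(2) in \<open>auto elim!: eventually_mono\<close>)
    then show ?thesis
      using fderiv_compose_linear[OF bounded_linear_Pair_zero(1), of \<mu> 0 y]
        twice_differentiable_imp_differentiable[OF M2] by (simp add: fderiv_eqI)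
  qed
  have pair0: "((\<lambda>g. (g, b)) has_derivative (\<lambda>x. (x, 0))) (at 0)" for b :: "'c::real_normed_vector"
    by (auto intro!: derivative_eq_intros)
  have "((\<lambda>g. fderiv G (g, a) (0, ?Hy)) has_derivative
      (\<lambda>x. fderiv (\<lambda>p. fderiv G p (0, ?Hy)) (0, a) (x, 0) + fderiv G (0, a) 0)) (at 0)"
    by (rule has_derivative_fderiv_apply[OF G2 pair0 _ has_derivative_const]) simp
  note wF = has_derivative_Pair[OF has_derivative_const[of "0 :: real^'n"] this]
  have L: "((\<lambda>g. fderiv F (g, G (g, a)) (0, fderiv G (g, a) (0, ?Hy))) has_derivative
      (\<lambda>x. fderiv (\<lambda>p. fderiv F p (0, fderiv G (0, a) (0, ?Hy))) (0, a) (x, generator G x a)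
         + fderiv F (0, a) (0, fderiv (\<lambda>p. fderiv G p (0, ?Hy)) (0, a) (x, 0) + fderiv G (0, a) 0))) (at 0)"
    by (rule has_derivative_fderiv_apply[OF F2
          has_derivative_Pair[OF has_derivative_ident local_family_param_has_derivative_0[OF G a]] _ wF])
      (simp add: G0)
  have "((\<lambda>g. fderiv \<mu> (g, 0) (0, y)) has_derivative
      (\<lambda>x. fderiv (\<lambda>p. fderiv \<mu> p (0, y)) (0, 0) (x, 0) + fderiv \<mu> (0, 0) 0)) (at 0)"
    by (rule has_derivative_fderiv_apply[OF M2 pair0 _ has_derivative_const]) simp
  note wH = has_derivative_Pair[OF this has_derivative_const[of "0 :: real^'m"]]
  have R: "((\<lambda>g. fderiv H (g, K (g, a)) (fderiv \<mu> (g, 0) (0, y), 0)) has_derivative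
      (\<lambda>x. fderiv (\<lambda>p. fderiv H p (fderiv \<mu> (0, 0) (0, y), 0)) (0, a) (x, generator K x a)
         + fderiv H (0, a) (fderiv (\<lambda>p. fderiv \<mu> p (0, y)) (0, 0) (x, 0) + fderiv \<mu> (0, 0) 0, 0))) (at 0)"
    by (rule has_derivative_fderiv_apply[OF H2
          has_derivative_Pair[OF has_derivative_ident local_family_param_has_derivative_0[OF K a]] _ wH])
      (simp add: K0)
  have ev: "\<forall>\<^sub>F g in nhds 0. fderiv F (g, G (g, a)) (0, fderiv G (g, a) (0, ?Hy))
      = fderiv H (g, K (g, a)) (fderiv \<mu> (g, 0) (0, y), 0)"
    using local_family_eventually_param[OF F] local_family_eventually_in[OF G a] local_family_eventually_in[OF K a]
  proof eventually_elim
    case (elim g)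
    show ?case
      by (rule action_first_order[OF F G H K]) (use elim a unit eq \<mu> in \<open>auto intro: twice_differentiable_imp_differentiable\<close>)
  qed
  note eq2 = fun_cong[OF has_derivative_unique[OF has_derivative_eventually_cong[OF L ev] R], of x]
  have lin0: "fderiv G (0, a) 0 = 0" "fderiv \<mu> (0, 0) 0 = 0"
    by (intro linear_0 linear_fderiv twice_differentiable_imp_differentiable G2 M2)+
  have "fderiv (\<lambda>p. fderiv F p (0, ?Hy)) (0, a) (x, generator G x a) = fderiv (generator F x) a ?Hy"
    by (simp add: fderiv2_local_family_split[OF F a, of _ x "generator G x a"] fderiv2_local_family_snd[OF F a]
        fderiv2_local_family_mixed[OF F a])
  moreover have "fderiv (\<lambda>p. fderiv H p (y, 0)) (0, a) (x, generator K x a)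
      = fderiv (\<lambda>p. fderiv H p (y, 0)) (0, a) (x, 0) + fderiv (generator H y) a (generator K x a)"
    by (simp add: fderiv2_local_family_split[OF H a, of _ x "generator K x a"] fderiv_generator[OF H a])
  ultimately show ?thesis
    using eq2
    by (simp add: lin0 M0 fderiv_local_family_snd[OF F a] fderiv_local_family_snd[OF G a]
        fderiv2_local_family_mixed[OF G a] fderiv_local_family[OF H a])
qed

text \<open>The parameter enters both maps. The second derivative of either composite consists of
  the pure parameter parts of \<open>F\<close> and \<open>G\<close>, the same for both orders of
  composition, and of two mixed terms; only the mixed terms remain in the comparison.\<close>

lemma commuting_families_second_order:
  fixes F G :: "(real^'n::finite) \<times> (real^'m::finite) \<Rightarrow> real^'m"
  assumes F: "local_family F N V" and G: "local_family G N V" and a: "a \<in> V"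
    and eq: "\<And>g. g \<in> N \<Longrightarrow> F (g, G (g, a)) = G (g, F (g, a))"
  shows "fderiv (generator F x) a (generator G y a) + fderiv (generator F y) a (generator G x a)
    = fderiv (generator G x) a (generator F y a) + fderiv (generator G y) a (generator F x a)"
proof -
  note N0 = local_family_zero[OF F]
  have first: "((\<lambda>g. A (g, B (g, a))) has_derivative (\<lambda>y. fderiv A (g, B (g, a)) (y, fderiv B (g, a) (y, 0)))) (at g)"
    if A: "local_family A N V" and B: "local_family B N V" and g: "g \<in> N" "B (g, a) \<in> V"
    for A B :: "(real^'n) \<times> (real^'m) \<Rightarrow> real^'m" and g
    by (rule has_derivative_compose[OF
          has_derivative_Pair[OF has_derivative_ident local_family_param_has_derivative[OF B g(1) a]]
          fderiv_works[OF local_family_differentiable[OF A g]]])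
  have second: "((\<lambda>g. fderiv A (g, B (g, a)) (y, fderiv B (g, a) (y, 0))) has_derivative
      (\<lambda>x. fderiv (\<lambda>p. fderiv A p (y, 0)) (0, a) (x, 0) + fderiv (\<lambda>p. fderiv B p (y, 0)) (0, a) (x, 0)
        + fderiv (generator A y) a (generator B x a) + fderiv (generator A x) a (generator B y a))) (at 0)"
    if A: "local_family A N V" and B: "local_family B N V"
    for A B :: "(real^'n) \<times> (real^'m) \<Rightarrow> real^'m"
  proof -
    note A2 = local_family_twice[OF A N0 a] and B2 = local_family_twice[OF B N0 a]
    have B0: "B (0, a) = a" using B a by (simp add: local_family_def)
    have "((\<lambda>g. (g, a)) has_derivative (\<lambda>x. (x, 0))) (at 0)"
      by (auto intro!: derivative_eq_intros)
    from has_derivative_fderiv_apply[OF B2 this _ has_derivative_const, of "(y, 0)"]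
    have "((\<lambda>g. fderiv B (g, a) (y, 0)) has_derivative
        (\<lambda>x. fderiv (\<lambda>p. fderiv B p (y, 0)) (0, a) (x, 0) + fderiv B (0, a) 0)) (at 0)"
      by simp
    note w = has_derivative_Pair[OF has_derivative_const[of y] this]
    have d: "((\<lambda>g. fderiv A (g, B (g, a)) (y, fderiv B (g, a) (y, 0))) has_derivative
      (\<lambda>x. fderiv (\<lambda>p. fderiv A p (y, fderiv B (0, a) (y, 0))) (0, a) (x, generator B x a)
        + fderiv A (0, a) (0, fderiv (\<lambda>p. fderiv B p (y, 0)) (0, a) (x, 0) + fderiv B (0, a) 0))) (at 0)"
      by (rule has_derivative_fderiv_apply[OF A2
          has_derivative_Pair[OF has_derivative_ident local_family_param_has_derivative_0[OF B a]] _ w])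
        (simp add: B0)
    have B00: "fderiv B (0, a) 0 = 0"
      by (intro linear_0 linear_fderiv twice_differentiable_imp_differentiable B2)
    \<comment> \<open>Linearity is directly available in the outer direction only, so symmetry is
      used to split the inner one. There is no term pure in \<open>v\<close> and
      \<open>w\<close>.\<close>
    have split: "fderiv (\<lambda>p. fderiv A p (y, v)) (0, a) (x, w)
      = fderiv (\<lambda>p. fderiv A p (y, 0)) (0, a) (x, 0) + fderiv (generator A y) a w
        + fderiv (generator A x) a v" for x v w
    proof -
      have "fderiv (\<lambda>p. fderiv A p (y, v)) (0, a) (x, w) = fderiv (\<lambda>p. fderiv A p (x, w)) (0, a) ((y, 0) + (0, v))"
        by (simp add: fderiv_fderiv_commute[OF A2, of "(y, v)"])
      also have "\<dots> = fderiv (\<lambda>p. fderiv A p (x, w)) (0, a) (y, 0) + fderiv (\<lambda>p. fderiv A p (x, w)) (0, a) (0, v)"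
        by (intro linear_add linear_fderiv local_family_fderiv_differentiable[OF A N0 a])
      also have "\<dots> = fderiv (\<lambda>p. fderiv A p (y, 0)) (0, a) (x, w) + fderiv (\<lambda>p. fderiv A p (0, v)) (0, a) (x, w)"
        by (simp add: fderiv_fderiv_commute[OF A2, of "(x, w)"])
      finally show ?thesis
        by (simp add: fderiv2_local_family_split[OF A a, of _ x w] fderiv2_local_family_snd[OF A a]
            fderiv2_local_family_mixed[OF A a] fderiv_generator[OF A a])
    qed
    show ?thesis
    proof (rule has_derivative_eq_rhs[OF d], rule ext)
      fix x
      show "fderiv (\<lambda>p. fderiv A p (y, fderiv B (0, a) (y, 0))) (0, a) (x, generator B x a)
          + fderiv A (0, a) (0, fderiv (\<lambda>p. fderiv B p (y, 0)) (0, a) (x, 0) + fderiv B (0, a) 0)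
        = fderiv (\<lambda>p. fderiv A p (y, 0)) (0, a) (x, 0) + fderiv (\<lambda>p. fderiv B p (y, 0)) (0, a) (x, 0)
          + fderiv (generator A y) a (generator B x a) + fderiv (generator A x) a (generator B y a)"
        unfolding split[of "fderiv B (0, a) (y, 0)" x "generator B x a"]
        by (simp add: B00 fderiv_local_family_snd[OF A a] generator_def[of B])
    qed
  qed
  have ev: "\<forall>\<^sub>F g in nhds 0. fderiv F (g, G (g, a)) (y, fderiv G (g, a) (y, 0))
      = fderiv G (g, F (g, a)) (y, fderiv F (g, a) (y, 0))"
    using local_family_eventually_param[OF F] local_family_eventually_in[OF G a] local_family_eventually_in[OF F a]
  proof eventually_elim
    case (elim g)
    have "\<forall>\<^sub>F g in nhds g. F (g, G (g, a)) = G (g, F (g, a))"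
      using F elim(1) eq by (auto simp: local_family_def intro!: eventually_mono[OF eventually_nhds_in_open[of N]])
    from has_derivative_unique[OF has_derivative_eventually_cong[OF first[OF F G elim(1,2)] this] first[OF G F elim(1,3)]]
    show ?case by meson
  qed
  from fun_cong[OF has_derivative_unique[OF has_derivative_eventually_cong[OF second[OF F G] ev] second[OF G F]], of x]
  show ?thesis by (simp add: algebra_simps)
qed


subsection \<open>The Yamaguti bracket\<close>

text \<open>The bilinear part of the product at the unit, with \<open>x\<close> in the first factor
  and \<open>y\<close> in the second. Its antisymmetrisation \<open>tangent_bracket\<close>
  therefore has the structure constants \<open>C^i_jk\<close>.\<close>

definition second_order_product ::
    "((real^'n) \<times> (real^'n) \<Rightarrow> real^'n) \<Rightarrow> real^'n \<Rightarrow> real^'n \<Rightarrow> real^'n::finite" where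
  "second_order_product \<mu> x y = fderiv (\<lambda>p. fderiv \<mu> p (0, y)) (0, 0) (x, 0)"

definition tangent_bracket ::
    "((real^'n) \<times> (real^'n) \<Rightarrow> real^'n) \<Rightarrow> real^'n \<Rightarrow> real^'n \<Rightarrow> real^'n::finite" where
  "tangent_bracket \<mu> x y = second_order_product \<mu> x y - second_order_product \<mu> y x"

lemma bounded_linear_swap: "bounded_linear (\<lambda>p :: 'a::real_normed_vector \<times> 'b::real_normed_vector. (snd p, fst p))"
  by (intro bounded_linear_Pair bounded_linear_fst bounded_linear_snd)

lemma second_order_product_swap:
  assumes \<mu>: "twice_differentiable \<mu> (0, 0)"
  shows "second_order_product (\<lambda>p. \<mu> (snd p, fst p)) x y = second_order_product \<mu> y x"
proof -
  let ?s = "\<lambda>p :: (real^'a) \<times> (real^'a). (snd p, fst p)"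
  have "\<forall>\<^sub>F p in nhds (0, 0). \<mu> differentiable (at (?s p))"
    by (rule eventually_compose_linear[OF bounded_linear_swap]) (use \<mu> in \<open>simp add: twice_differentiable_def\<close>)
  then have ev: "\<forall>\<^sub>F p in nhds (0, 0). fderiv \<mu> (?s p) (y, 0) = fderiv (\<lambda>p. \<mu> (?s p)) p (0, y)"
    by (rule eventually_mono) (simp add: fderiv_compose_linear[OF bounded_linear_swap])
  have d: "(\<lambda>q. fderiv \<mu> q (y, 0)) differentiable (at (?s (0, 0)))"
    using \<mu> by (simp add: twice_differentiable_def)
  have "fderiv (\<lambda>p. fderiv (\<lambda>p. \<mu> (?s p)) p (0, y)) (0, 0) (x, 0) = fderiv (\<lambda>p. fderiv \<mu> (?s p) (y, 0)) (0, 0) (x, 0)"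
    by (rule fun_cong[OF fderiv_eventually_cong(2)[OF differentiable_compose_linear[OF bounded_linear_swap d] ev]])
  also have "\<dots> = fderiv (\<lambda>q. fderiv \<mu> q (y, 0)) (0, 0) (0, x)"
    using fderiv_compose_linear[OF bounded_linear_swap d, of "(x, 0)"] by simp
  also have "\<dots> = fderiv (\<lambda>q. fderiv \<mu> q (0, x)) (0, 0) (y, 0)"
    by (rule fderiv_fderiv_commute[OF \<mu>])
  finally show ?thesis by (simp add: second_order_product_def)
qed

lemma second_order_product_linear_left:
  assumes "twice_differentiable \<mu> (0, 0)"
  shows "linear (\<lambda>x. second_order_product \<mu> x y)"
proof -
  have "linear (fderiv (\<lambda>p. fderiv \<mu> p (0, y)) (0, 0))"
    using assms by (intro linear_fderiv) (simp add: twice_differentiable_def)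
  from linear_compose[OF bounded_linear.linear[OF bounded_linear_Pair_zero(2)] this]
  show ?thesis by (simp add: second_order_product_def[abs_def] o_def)
qed

lemma second_order_product_linear_right:
  assumes "twice_differentiable \<mu> (0, 0)"
  shows "linear (\<lambda>y. second_order_product \<mu> x y)"
  using second_order_product_linear_left[of "\<lambda>p. \<mu> (snd p, fst p)" x] second_order_product_swap[OF assms, of _ x]
    twice_differentiable_compose_linear[OF bounded_linear_swap, of \<mu> "(0, 0)"] assms
  by simp

lemma
  assumes "twice_differentiable \<mu> (0, 0)"
  shows tangent_bracket_linear_left: "linear (\<lambda>x. tangent_bracket \<mu> x y)"
    and tangent_bracket_linear_right: "linear (\<lambda>y. tangent_bracket \<mu> x y)"
  unfolding tangent_bracket_def
  by (intro linear_compose_sub second_order_product_linear_left second_order_product_linear_right assms)+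

text \<open>By skew-symmetry of the tangent bracket this is
  \<open>[x,[y,z]] - [y,[x,z]] + [[x,y],z]\<close>.\<close>

definition triple_bracket ::
    "((real^'n) \<times> (real^'n) \<Rightarrow> real^'n) \<Rightarrow> real^'n \<Rightarrow> real^'n \<Rightarrow> real^'n \<Rightarrow> real^'n::finite" where
  "triple_bracket \<mu> x y z = tangent_bracket \<mu> (tangent_bracket \<mu> x y) z
     - tangent_bracket \<mu> (tangent_bracket \<mu> y z) x - tangent_bracket \<mu> (tangent_bracket \<mu> z x) y"

lemma triple_bracket_linear:
  assumes "twice_differentiable \<mu> (0, 0)"
  shows "linear (\<lambda>x. triple_bracket \<mu> x y z)" "linear (\<lambda>y. triple_bracket \<mu> x y z)" "linear (triple_bracket \<mu> x y)"
proof -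
  note l = tangent_bracket_linear_left[OF assms] and r = tangent_bracket_linear_right[OF assms]
  note ll = linear_compose[OF l l, unfolded o_def] and rl = linear_compose[OF r l, unfolded o_def]
  show "linear (\<lambda>x. triple_bracket \<mu> x y z)" "linear (\<lambda>y. triple_bracket \<mu> x y z)" "linear (triple_bracket \<mu> x y)"
    unfolding triple_bracket_def by (intro linear_compose_sub ll rl l r)+
qed

lemma triple_bracket_expand:
  assumes "twice_differentiable \<mu> (0, 0)"
  shows "(\<Sum>j\<in>UNIV. \<Sum>k\<in>UNIV. \<Sum>l\<in>UNIV.
      (x $ j * y $ k * z $ l) *\<^sub>R triple_bracket \<mu> (axis j 1) (axis k 1) (axis l 1)) = triple_bracket \<mu> x y z"
proof -
  note lin = triple_bracket_linear[OF assms]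
  have "(\<Sum>j\<in>UNIV. \<Sum>k\<in>UNIV. \<Sum>l\<in>UNIV.
      (x $ j * y $ k * z $ l) *\<^sub>R triple_bracket \<mu> (axis j 1) (axis k 1) (axis l 1))
    = (\<Sum>j\<in>UNIV. x $ j *\<^sub>R (\<Sum>k\<in>UNIV. y $ k *\<^sub>R (\<Sum>l\<in>UNIV.
        z $ l *\<^sub>R triple_bracket \<mu> (axis j 1) (axis k 1) (axis l 1))))"
    by (simp add: scaleR_sum_right mult.assoc)
  then show ?thesis
    by (simp only: linear_eq_sum_axis[OF lin(1)] linear_eq_sum_axis[OF lin(2)] linear_eq_sum_axis[OF lin(3)])
qed

text \<open>Covers both an action read in a chart and the loop with its left and right translations
  as \<open>F\<close> and \<open>G\<close>. All germ conditions are moved to fixed neighbourhoods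
  \<open>N\<close> and \<open>V\<close>.\<close>

locale moufang_pair =
  fixes \<mu> :: "(real^'n::finite) \<times> (real^'n) \<Rightarrow> real^'n"
    and F G :: "(real^'n) \<times> (real^'m::finite) \<Rightarrow> real^'m" and N V
  assumes F: "local_family F N V" and G: "local_family G N V"
    and \<mu>: "\<And>g h. g \<in> N \<Longrightarrow> h \<in> N \<Longrightarrow> twice_differentiable \<mu> (g, h)"
    and unit: "\<And>g. g \<in> N \<Longrightarrow> \<mu> (g, 0) = g" "\<And>g. g \<in> N \<Longrightarrow> \<mu> (0, g) = g"
    and act_F: "\<And>g h a. g \<in> N \<Longrightarrow> h \<in> N \<Longrightarrow> a \<in> V \<Longrightarrow> F (g, G (g, F (h, a))) = F (\<mu> (g, h), G (g, a))"
    and act_G: "\<And>g h a. g \<in> N \<Longrightarrow> h \<in> N \<Longrightarrow> a \<in> V \<Longrightarrow> F (g, G (g, G (h, a))) = G (\<mu> (h, g), F (g, a))"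
begin

lemma product_twice: "twice_differentiable \<mu> (0, 0)"
  by (intro \<mu> local_family_zero[OF F])

text \<open>The case \<open>h = 0\<close> of \<open>act_G\<close>; it is the source of the relation
  \<open>ST\<close>.\<close>

lemma act_commute:
  assumes "g \<in> N" "a \<in> V"
  shows "F (g, G (g, a)) = G (g, F (g, a))"
  using act_G[OF assms(1) local_family_zero[OF F] assms(2)] G assms unit by (simp add: local_family_def)

sublocale triality_fields "generator F" "generator G" V "tangent_bracket \<mu>"
proof (rule triality_fields.intro)
  show "open V" using F by (simp add: local_family_def)
  fix b assume b: "b \<in> V"
  show "linear (\<lambda>x. generator F x b)" "linear (\<lambda>x. generator G x b)"
    using F G b by (auto intro: generator_linear)
  show "twice_differentiable (generator F x) b" "twice_differentiable (generator G x) b" for x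
    using F G b by (auto intro: generator_twice_differentiable)
  note d = generator_twice_differentiable[OF F b, THEN twice_differentiable_imp_differentiable]
    generator_twice_differentiable[OF G b, THEN twice_differentiable_imp_differentiable]
  have FG: "fderiv (generator F x) b (generator F y b) + fderiv (generator G x) b (generator F y b)
    = fderiv (\<lambda>p. fderiv F p (y, 0)) (0, b) (x, 0) + fderiv (generator F y) b (generator G x b)
      + generator F (second_order_product \<mu> x y) b" for x y
    unfolding second_order_product_def
    by (rule action_second_order[OF F G F G]) (use \<mu> unit act_F b local_family_zero[OF F] in auto)
  have GF: "fderiv (generator F x) b (generator G y b) + fderiv (generator G x) b (generator G y b)
    = fderiv (\<lambda>p. fderiv G p (y, 0)) (0, b) (x, 0) + fderiv (generator G y) b (generator F x b)
      + generator G (second_order_product \<mu> y x) b" for x y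
    \<comment> \<open>The second identity carries \<open>\<mu> (h, g)\<close>, so the template is
      applied to the opposite product. This is why the tangent bracket enters \<open>TT\<close> with
      a minus sign.\<close>
    unfolding second_order_product_swap[OF product_twice, symmetric] unfolding second_order_product_def
    by (rule action_second_order[OF F G G F])
      (use \<mu> unit act_G b local_family_zero[OF F] in \<open>auto intro!: twice_differentiable_compose_linear[OF bounded_linear_swap]\<close>)
  have com: "fderiv (generator F x) b (generator G y b) + fderiv (generator F y) b (generator G x b)
    = fderiv (generator G x) b (generator F y b) + fderiv (generator G y) b (generator F x b)" for x y
    by (rule commuting_families_second_order[OF F G b act_commute[OF _ b]])
  note sym = fderiv_fderiv_commute[OF local_family_twice[OF F local_family_zero[OF F] b]]
    fderiv_fderiv_commute[OF local_family_twice[OF G local_family_zero[OF G] b]]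
  note diff = linear_diff[OF generator_linear[OF F b]] linear_diff[OF generator_linear[OF G b]]
  fix x y
  show "vf_bracket (generator F x) (generator G y) b = - vf_bracket (generator F y) (generator G x) b"
    using com[of x y] unfolding vf_bracket_eq_fderiv[OF d(1) d(2)] by (simp add: algebra_simps)
  \<comment> \<open>In the difference of \<open>FG\<close> for the two orders the second parameter
    derivatives cancel by \<open>sym\<close>; the two remaining brackets of an \<open>F\<close>
    field with a \<open>G\<close> field are identified by \<open>com\<close>.\<close>
  show "vf_bracket (generator F x) (generator F y) b
      = generator F (tangent_bracket \<mu> x y) b - 2 *\<^sub>R vf_bracket (generator F x) (generator G y) b"
    using FG[of x y] FG[of y x] com[of x y] sym(1)[of "(y, 0)" "(x, 0)"]
    unfolding vf_bracket_eq_fderiv[OF d(1) d(2)] vf_bracket_eq_fderiv[OF d(1) d(1)] tangent_bracket_def diff vec_eq_iff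
    by (simp add: algebra_simps) smt
  show "vf_bracket (generator G x) (generator G y) b
      = - generator G (tangent_bracket \<mu> x y) b - 2 *\<^sub>R vf_bracket (generator F x) (generator G y) b"
    using GF[of x y] GF[of y x] com[of x y] sym(2)[of "(y, 0)" "(x, 0)"]
    unfolding vf_bracket_eq_fderiv[OF d(1) d(2)] vf_bracket_eq_fderiv[OF d(2) d(2)] tangent_bracket_def diff vec_eq_iff
    by (simp add: algebra_simps) smt
qed

end

section \<open>Germ conditions on common neighbourhoods, and the loop acting on itself\<close>

lemma eventually_nhds_prodE:
  assumes "\<forall>\<^sub>F p in nhds (a, b). P p"
  obtains A B where "open A" "a \<in> A" "open B" "b \<in> B" "\<And>x y. x \<in> A \<Longrightarrow> y \<in> B \<Longrightarrow> P (x, y)"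
proof -
  obtain S where "open S" "(a, b) \<in> S" "\<forall>p\<in>S. P p"
    using assms unfolding eventually_nhds by blast
  moreover obtain A B where "open A" "open B" "(a, b) \<in> A \<times> B" "A \<times> B \<subseteq> S"
    using \<open>open S\<close> \<open>(a, b) \<in> S\<close> by (rule open_prod_elim)
  ultimately show thesis
    by (intro that[of A B]) auto
qed

lemma local_analytic_moufang_loopE:
  fixes m :: "real^'n::finite \<Rightarrow> real^'n \<Rightarrow> real^'n"
  assumes "local_analytic_moufang_loop m"
  obtains N where "open N" "0 \<in> N"
    "\<And>g h. g \<in> N \<Longrightarrow> h \<in> N \<Longrightarrow> thrice_differentiable (\<lambda>p. m (fst p) (snd p)) (g, h)"
    "\<And>g. g \<in> N \<Longrightarrow> m 0 g = g" "\<And>g. g \<in> N \<Longrightarrow> m g 0 = g"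
    "\<And>g h k. g \<in> N \<Longrightarrow> h \<in> N \<Longrightarrow> k \<in> N \<Longrightarrow> m (m g h) (m k g) = m g (m (m h k) g)"
proof -
  obtain U where U: "open U" "0 \<in> U" "real_analytic_on (\<lambda>(g, h). m g h) (U \<times> U)"
    using assms unfolding local_analytic_moufang_loop_def by blast
  have "\<forall>\<^sub>F g in nhds 0. m 0 g = g \<and> m g 0 = g"
    using assms unfolding local_analytic_moufang_loop_def by blast
  then obtain E where E: "open E" "0 \<in> E" "\<And>g. g \<in> E \<Longrightarrow> m 0 g = g \<and> m g 0 = g"
    unfolding eventually_nhds by blast
  have "\<forall>\<^sub>F (g, h, k) in nhds (0, 0, 0). m (m g h) (m k g) = m g (m (m h k) g)"
    using assms unfolding local_analytic_moufang_loop_def by blast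
  then obtain A B where A: "open A" "0 \<in> A" and B: "open B" "(0, 0) \<in> B"
    and AB: "\<And>g p. g \<in> A \<Longrightarrow> p \<in> B \<Longrightarrow> case (g, p) of (g, h, k) \<Rightarrow> m (m g h) (m k g) = m g (m (m h k) g)"
    by (rule eventually_nhds_prodE) blast
  obtain C D where C: "open C" "0 \<in> C" and D: "open D" "0 \<in> D" and CD: "C \<times> D \<subseteq> B"
    by (rule open_prod_elim[OF B]) blast
  show thesis
  proof (rule that[of "U \<inter> E \<inter> A \<inter> C \<inter> D"])
    fix g h k assume *: "g \<in> U \<inter> E \<inter> A \<inter> C \<inter> D" "h \<in> U \<inter> E \<inter> A \<inter> C \<inter> D"
    then show "thrice_differentiable (\<lambda>p. m (fst p) (snd p)) (g, h)"
      using real_analytic_on_imp_thrice_differentiable[OF U(3) open_Times[OF U(1,1)], of "(g, h)"]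
      by (simp add: case_prod_unfold)
    assume "k \<in> U \<inter> E \<inter> A \<inter> C \<inter> D"
    then show "m (m g h) (m k g) = m g (m (m h k) g)"
      using AB[of g "(h, k)"] CD * by auto
  qed (use U E A C D in auto)
qed

lemma partial_deriv_param_local_family:
  assumes F: "local_family F N V" and a: "a \<in> V"
  shows "partial_deriv j (\<lambda>g. F (g, a)) 0 = generator F (axis j 1) a"
proof -
  note d = local_family_param_has_derivative_0[OF F a]
  then have "(\<lambda>g. F (g, a)) differentiable (at 0)" by (auto simp: differentiable_def)
  then show ?thesis by (simp add: partial_deriv_eq_fderiv fderiv_eqI[OF d])
qed

lemma yamaguti_bracket_eq:
  fixes m :: "real^'n::finite \<Rightarrow> real^'n \<Rightarrow> real^'n"
  assumes "local_analytic_moufang_loop m"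
  shows "yamaguti_bracket m x y z = triple_bracket (\<lambda>p. m (fst p) (snd p)) x y z"
proof -
  define M where "M = (\<lambda>p. m (fst p) (snd p))"
  define M' where "M' = (\<lambda>p. M (snd p, fst p))"
  obtain N where N: "open N" "0 \<in> N"
    and sm: "\<And>g h. g \<in> N \<Longrightarrow> h \<in> N \<Longrightarrow> thrice_differentiable M (g, h)"
    and unit: "\<And>g. g \<in> N \<Longrightarrow> m 0 g = g" "\<And>g. g \<in> N \<Longrightarrow> m g 0 = g"
    and mouf: "\<And>g h k. g \<in> N \<Longrightarrow> h \<in> N \<Longrightarrow> k \<in> N \<Longrightarrow> m (m g h) (m k g) = m g (m (m h k) g)"
    unfolding M_def by (rule local_analytic_moufang_loopE[OF assms]) blast
  have famM: "local_family M N N"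
    using N sm unit by (auto simp: local_family_def M_def)
  have "thrice_differentiable M' (g, h)" if "g \<in> N" "h \<in> N" for g h
    using thrice_differentiable_compose_linear[OF bounded_linear_swap, of M "(g, h)"] sm[OF that(2,1)]
    by (simp add: M'_def)
  then have famM': "local_family M' N N"
    using N unit by (auto simp: local_family_def M'_def M_def)
  \<comment> \<open>Unfolded, \<open>act_F\<close> and \<open>act_G\<close> are both the Moufang
    identity: \<open>a\<close> takes the place of \<open>k\<close> in the former, while
    \<open>a\<close> and \<open>h\<close> take those of \<open>h\<close> and \<open>k\<close> in the
    latter.\<close>
  interpret L: moufang_pair M M M' N N
  proof
    show "twice_differentiable M (g, h)" if "g \<in> N" "h \<in> N" for g h
      using sm[OF that] by (simp add: thrice_differentiable_def)
  qed (use famM famM' unit mouf in \<open>simp_all add: M_def M'_def\<close>)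
  let ?Y = "\<lambda>j k. six_yamagutian (generator M) (generator M') (axis j 1) (axis k 1)"
  have u: "loop_u m j b = generator M (axis j 1) b" if "b \<in> N" for j b
    using partial_deriv_param_local_family[OF famM that] by (simp add: loop_u_def M_def)
  have v: "loop_v m j b = generator M' (axis j 1) b" if "b \<in> N" for j b
    using partial_deriv_param_local_family[OF famM' that] by (simp add: loop_v_def M_def M'_def)
  have Y: "loop_Y m j k b = (1/6) *\<^sub>R ?Y j k b" if b: "b \<in> N" for j k b
  proof -
    have P: "(\<lambda>b. - generator M x b - generator M' x b) differentiable (at b)" for x
      by (intro differentiable_diff differentiable_minus L.S1 L.T1 b)
    have "vf_bracket (loop_u m j) (loop_u m k) b = vf_bracket (generator M (axis j 1)) (generator M (axis k 1)) b"
      by (rule vf_bracket_cong[OF L.S1[OF b] L.S1[OF b]]) (auto intro: L.eventually_V[OF b] simp: u)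
    moreover have "vf_bracket (loop_v m j) (loop_v m k) b = vf_bracket (generator M' (axis j 1)) (generator M' (axis k 1)) b"
      by (rule vf_bracket_cong[OF L.T1[OF b] L.T1[OF b]]) (auto intro: L.eventually_V[OF b] simp: v)
    moreover have "vf_bracket (loop_w m j) (loop_w m k) b
        = vf_bracket (\<lambda>b. - generator M (axis j 1) b - generator M' (axis j 1) b)
            (\<lambda>b. - generator M (axis k 1) b - generator M' (axis k 1) b) b"
      by (rule vf_bracket_cong[OF P P]) (auto intro: L.eventually_V[OF b] simp: loop_w_def u v)
    ultimately show ?thesis by (simp add: loop_Y_def six_yamagutian_def)
  qed
  have gen0: "generator M x 0 = x" "generator M' x 0 = x" for x
  proof -
    have "((\<lambda>g. g) has_derivative (\<lambda>x. generator M x 0)) (at 0)"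
      using local_family_param_has_derivative_0[OF famM N(2)]
      by (rule has_derivative_eventually_cong) (rule L.eventually_V[OF N(2)], simp add: M_def unit)
    then show "generator M x 0 = x" using fderiv_eqI fderiv_eqI[OF has_derivative_ident] by metis
    have "((\<lambda>g. g) has_derivative (\<lambda>x. generator M' x 0)) (at 0)"
      using local_family_param_has_derivative_0[OF famM' N(2)]
      by (rule has_derivative_eventually_cong) (rule L.eventually_V[OF N(2)], simp add: M_def M'_def unit)
    then show "generator M' x 0 = x" using fderiv_eqI fderiv_eqI[OF has_derivative_ident] by metis
  qed
  have swap: "fderiv (\<lambda>p. fderiv M' p (0, x)) (0, 0) (y, 0) = fderiv (\<lambda>p. fderiv M p (0, y)) (0, 0) (x, 0)" for x y
    using second_order_product_swap[OF L.product_twice] by (simp add: second_order_product_def M'_def)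
  \<comment> \<open>Both halves of this bracket are the mixed second derivative of the product along
    \<open>x\<close> and \<open>y\<close>.\<close>
  have "vf_bracket (generator M x) (generator M' y) 0 = 0" for x y
    unfolding vf_bracket_eq_fderiv[OF L.S1[OF N(2)] L.T1[OF N(2)]]
      fderiv2_local_family_mixed[OF famM N(2), symmetric] fderiv2_local_family_mixed[OF famM' N(2), symmetric]
    by (simp add: gen0 swap)
  then have Y0: "?Y j k 0 = 0" for j k
    by (simp add: L.six_yamagutian_eq[OF N(2)] gen0)
  \<comment> \<open>At the unit \<open>?Y\<close> vanishes and the field of \<open>z\<close> has the
    value \<open>z\<close>, so their bracket reduces to the derivative of \<open>?Y\<close> along
    \<open>z\<close>, the coefficient that \<open>yamaguti_bracket\<close> extracts.\<close>
  have dY: "fderiv (?Y j k) 0 z = triple_bracket M (axis j 1) (axis k 1) z" for j k z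
  proof -
    have "fderiv (generator M z) 0 0 = 0"
      by (rule linear_0[OF linear_fderiv[OF L.S1[OF N(2)]]])
    then show ?thesis
      using L.bracket_six_yamagutian_S_T(1)[OF N(2), of "axis j 1" "axis k 1" z]
      unfolding vf_bracket_eq_fderiv[OF L.six_yamagutian_differentiable[OF N(2)] L.S1[OF N(2)]]
      by (simp add: gen0 Y0 triple_bracket_def)
  qed
  have "partial_deriv l (loop_Y m j k) 0 = (1/6) *\<^sub>R triple_bracket M (axis j 1) (axis k 1) (axis l 1)" for j k l
  proof -
    have "((\<lambda>b. (1/6) *\<^sub>R ?Y j k b) has_derivative (\<lambda>z. (1/6) *\<^sub>R fderiv (?Y j k) 0 z)) (at 0)"
      by (intro has_derivative_scaleR_right fderiv_works L.six_yamagutian_differentiable N)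
    then have d: "(loop_Y m j k has_derivative (\<lambda>z. (1/6) *\<^sub>R fderiv (?Y j k) 0 z)) (at 0)"
      by (rule has_derivative_eventually_cong) (rule L.eventually_V[OF N(2)], simp add: Y)
    then have "loop_Y m j k differentiable (at 0)" by (auto simp: differentiable_def)
    then show ?thesis by (simp add: partial_deriv_eq_fderiv fderiv_eqI[OF d] dY)
  qed
  then show ?thesis
    unfolding yamaguti_bracket_def M_def[symmetric]
    using triple_bracket_expand[OF L.product_twice, of x y z] by (simp add: mult.assoc)
qed


subsection \<open>The action in a chart\<close>

lemma analytic_family_chartE:
  fixes F :: "real^'n::finite \<Rightarrow> 'x::topological_space \<Rightarrow> 'x" and \<phi> :: "'x \<Rightarrow> real^'m::finite"
  assumes "analytic_family \<A> F" "(U, \<phi>) \<in> \<A>" "A \<in> U"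
  obtains N where "open N" "(0, \<phi> A) \<in> N" "N \<subseteq> UNIV \<times> \<phi> ` U"
    "\<And>g a. (g, a) \<in> N \<Longrightarrow> F g (inv_into U \<phi> a) \<in> U"
    "\<And>p. p \<in> N \<Longrightarrow> thrice_differentiable (\<lambda>p. \<phi> (F (fst p) (inv_into U \<phi> (snd p)))) p"
proof -
  have "\<exists>N. open N \<and> (0, \<phi> A) \<in> N \<and> N \<subseteq> UNIV \<times> \<phi> ` U \<and>
            (\<forall>(g, a)\<in>N. F g (inv_into U \<phi> a) \<in> U) \<and>
            real_analytic_on (\<lambda>(g, a). \<phi> (F g (inv_into U \<phi> a))) N"
    using assms unfolding analytic_family_def by blast
  then obtain N where N: "open N" "(0, \<phi> A) \<in> N" "N \<subseteq> UNIV \<times> \<phi> ` U"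
    and FU: "\<forall>(g, a)\<in>N. F g (inv_into U \<phi> a) \<in> U"
    and an: "real_analytic_on (\<lambda>(g, a). \<phi> (F g (inv_into U \<phi> a))) N"
    by (elim exE conjE)
  show thesis
  proof (rule that[OF N])
    show "thrice_differentiable (\<lambda>p. \<phi> (F (fst p) (inv_into U \<phi> (snd p)))) p" if "p \<in> N" for p
      using real_analytic_on_imp_thrice_differentiable[OF an N(1) that] by (simp add: case_prod_unfold)
  qed (use FU in auto)
qed

text \<open>A composite can be read in one chart only while its intermediate points stay in
  \<open>U\<close>, where \<open>inv_into\<close> undoes \<open>\<phi>\<close>. The neighbourhoods
  are shrunk until this and the action identities hold together.\<close>

lemma moufang_action_chartE:
  fixes m :: "real^'n::finite \<Rightarrow> real^'n \<Rightarrow> real^'n"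
    and \<A> :: "('x::topological_space, 'm::finite) chart set"
  assumes m: "local_analytic_moufang_loop m" and \<A>: "analytic_atlas \<A>"
    and act: "moufang_action m \<A> S T" and c: "(U, \<phi>) \<in> \<A>" and A: "A \<in> U"
  obtains N V where "\<phi> A \<in> V"
    "moufang_pair (\<lambda>p. m (fst p) (snd p)) (\<lambda>p. \<phi> (S (fst p) (inv_into U \<phi> (snd p))))
      (\<lambda>p. \<phi> (T (fst p) (inv_into U \<phi> (snd p)))) N V"
proof -
  define M where "M = (\<lambda>p. m (fst p) (snd p))"
  define F where "F = (\<lambda>p. \<phi> (S (fst p) (inv_into U \<phi> (snd p))))"
  define G where "G = (\<lambda>p. \<phi> (T (fst p) (inv_into U \<phi> (snd p))))"
  let ?i = "inv_into U \<phi>"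
  have chart: "open U" "open (\<phi> ` U)" "homeomorphism U (\<phi> ` U) \<phi> ?i"
    using \<A> c unfolding analytic_atlas_def is_chart_def by auto
  have i: "?i (\<phi> B) = B" if "B \<in> U" for B
    using homeomorphism_apply1[OF chart(3) that] .
  have \<phi>i: "\<phi> (?i a) = a" if "a \<in> \<phi> ` U" for a
    using homeomorphism_apply2[OF chart(3) that] .
  have id: "S 0 B = B" "T 0 B = B" for B
    using act unfolding moufang_action_def by auto
  obtain NS where NS: "open NS" "(0, \<phi> A) \<in> NS" "NS \<subseteq> UNIV \<times> \<phi> ` U"
    and SU: "\<And>g a. (g, a) \<in> NS \<Longrightarrow> S g (?i a) \<in> U"
    and F3: "\<And>p. p \<in> NS \<Longrightarrow> thrice_differentiable F p"
    unfolding F_def by (rule analytic_family_chartE[of \<A> S U \<phi> A]) (use act c A in \<open>auto simp: moufang_action_def\<close>)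
  obtain NT where NT: "open NT" "(0, \<phi> A) \<in> NT" "NT \<subseteq> UNIV \<times> \<phi> ` U"
    and TU: "\<And>g a. (g, a) \<in> NT \<Longrightarrow> T g (?i a) \<in> U"
    and G3: "\<And>p. p \<in> NT \<Longrightarrow> thrice_differentiable G p"
    unfolding G_def by (rule analytic_family_chartE[of \<A> T U \<phi> A]) (use act c A in \<open>auto simp: moufang_action_def\<close>)
  have "(0, \<phi> A) \<in> NS \<inter> NT" "open (NS \<inter> NT)"
    using NS NT by auto
  then obtain N1 V1 where N1: "open N1" "0 \<in> N1" and V1: "open V1" "\<phi> A \<in> V1" and NV1: "N1 \<times> V1 \<subseteq> NS \<inter> NT"
    by (elim open_prod_elim) auto
  have F0: "F (0, a) = a" and G0: "G (0, a) = a" if "a \<in> \<phi> ` U" for a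
    using \<phi>i[OF that] by (simp_all add: F_def G_def id)
  have near: "\<forall>\<^sub>F p in nhds (0, \<phi> A). H p \<in> V1"
    if H3: "thrice_differentiable H (0, \<phi> A)" and H0: "H (0, \<phi> A) = \<phi> A"
    for H :: "(real^'n) \<times> (real^'m) \<Rightarrow> real^'m"
  proof -
    have "isCont H (0, \<phi> A)"
      using H3 twice_differentiable_imp_differentiable differentiable_imp_continuous_within
      unfolding thrice_differentiable_def by blast
    then have "filterlim H (nhds (\<phi> A)) (nhds (0, \<phi> A))"
      using tendsto_at_iff_tendsto_nhds[of H "(0, \<phi> A)"] H0 by (simp add: continuous_at)
    then show ?thesis
      using eventually_compose_filterlim[OF eventually_nhds_in_open[OF V1]] by blast
  qed
  have "\<forall>\<^sub>F p in nhds (0, \<phi> A). F p \<in> V1 \<and> G p \<in> V1"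
    using A NS(2) NT(2) by (intro eventually_conj near F3 G3 F0 G0) auto
  \<comment> \<open>Room for the second transformation: the first one keeps the points of
    \<open>V2\<close> inside \<open>V1\<close>, where the families are still controlled.\<close>
  then obtain N2 V2 where N2: "open N2" "0 \<in> N2" and V2: "open V2" "\<phi> A \<in> V2"
    and NV2: "\<And>g a. g \<in> N2 \<Longrightarrow> a \<in> V2 \<Longrightarrow> F (g, a) \<in> V1 \<and> G (g, a) \<in> V1"
    by (rule eventually_nhds_prodE) blast
  have "\<forall>\<^sub>F (g, h, B) in nhds (0, 0, A).
      S g (T g (S h B)) = S (m g h) (T g B) \<and> S g (T g (T h B)) = T (m h g) (S g B)"
    using act unfolding moufang_action_def by blast
  then obtain N3 Q where N3: "open N3" "0 \<in> N3" and Q: "open Q" "(0, A) \<in> Q"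
    and act3: "\<And>g q. g \<in> N3 \<Longrightarrow> q \<in> Q \<Longrightarrow> case (g, q) of (g, h, B) \<Rightarrow>
      S g (T g (S h B)) = S (m g h) (T g B) \<and> S g (T g (T h B)) = T (m h g) (S g B)"
    by (rule eventually_nhds_prodE) blast
  obtain N4 W where N4: "open N4" "0 \<in> N4" and W: "open W" "A \<in> W" and NW: "N4 \<times> W \<subseteq> Q"
    by (rule open_prod_elim[OF Q]) blast
  obtain N5 where N5: "open N5" "0 \<in> N5"
    and M3: "\<And>g h. g \<in> N5 \<Longrightarrow> h \<in> N5 \<Longrightarrow> thrice_differentiable M (g, h)"
    and unit: "\<And>g. g \<in> N5 \<Longrightarrow> m 0 g = g" "\<And>g. g \<in> N5 \<Longrightarrow> m g 0 = g"
    unfolding M_def by (rule local_analytic_moufang_loopE[OF m]) blast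
  define N where "N = N1 \<inter> N2 \<inter> N3 \<inter> N4 \<inter> N5"
  \<comment> \<open>The last factor carries \<open>W\<close>, a neighbourhood of \<open>A\<close> on
    which the action identities hold, into coordinates.\<close>
  define V where "V = V1 \<inter> V2 \<inter> (\<phi> ` U \<inter> ?i -` W)"
  have "open (\<phi> ` U \<inter> ?i -` W)"
    using chart W(1) by (intro continuous_open_preimage) (auto simp: homeomorphism_def)
  then have oV: "open V" unfolding V_def using V1 V2 by auto
  have oN: "open N" "0 \<in> N" unfolding N_def using N1 N2 N3 N4 N5 by auto
  have inN: "(g, a) \<in> NS" "(g, a) \<in> NT" if "g \<in> N" "a \<in> V1" for g a
    using that NV1 unfolding N_def by auto
  have FB: "F (g, \<phi> B) = \<phi> (S g B)" "G (g, \<phi> B) = \<phi> (T g B)" if "B \<in> U" for g B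
    using i[OF that] by (simp_all add: F_def G_def)
  have acts: "S g (T g (S h (?i a))) = S (m g h) (T g (?i a))"
    "S g (T g (T h (?i a))) = T (m h g) (S g (?i a))" if "g \<in> N" "h \<in> N" "a \<in> V" for g h a
    using act3[of g "(h, ?i a)"] that NW unfolding N_def V_def by auto
  have V: "a \<in> V1" "a \<in> \<phi> ` U" if "a \<in> V" for a using that by (auto simp: V_def)
  have FV: "F (g, a) \<in> V1" "G (g, a) \<in> V1" if "g \<in> N" "a \<in> V" for g a
    using NV2[of g a] that by (auto simp: N_def V_def)
  show thesis
  proof (rule that[of V N])
    show "\<phi> A \<in> V" unfolding V_def using V1 V2 W A i by auto
    show "moufang_pair (\<lambda>p. m (fst p) (snd p)) (\<lambda>p. \<phi> (S (fst p) (?i (snd p)))) (\<lambda>p. \<phi> (T (fst p) (?i (snd p)))) N V"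
      unfolding M_def[symmetric] F_def[symmetric] G_def[symmetric]
    proof
      show "local_family F N V" "local_family G N V"
        using oN oV F0 G0 F3 G3 inN V unfolding local_family_def by auto
      show "twice_differentiable M (g, h)" if "g \<in> N" "h \<in> N" for g h
        using M3 that by (simp add: N_def thrice_differentiable_def)
      show "M (g, 0) = g" "M (0, g) = g" if "g \<in> N" for g
        using unit that by (simp_all add: N_def M_def)
      fix g h a assume g: "g \<in> N" and h: "h \<in> N" and a: "a \<in> V"
      define B where "B = ?i a"
      have aB: "a = \<phi> B" and B: "B \<in> U"
        using \<phi>i V(2)[OF a] inv_into_into[of a \<phi> U] by (auto simp: B_def)
      have U1: "S k B \<in> U" "T k B \<in> U" if "k \<in> N" for k
        using SU[OF inN(1)[OF that V(1)[OF a]]] TU[OF inN(2)[OF that V(1)[OF a]]] by (simp_all add: B_def)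
      have "T g (?i (F (h, a))) \<in> U" "T g (?i (G (h, a))) \<in> U"
        using TU[OF inN(2)[OF g]] FV[OF h a] by auto
      then have U2: "T g (S h B) \<in> U" "T g (T h B) \<in> U"
        using U1[OF h] by (simp_all add: aB FB B i)
      \<comment> \<open>\<open>M (g, h)\<close> may lie outside \<open>N\<close>: as
        \<open>F\<close> is total, cancelling the charts on the right takes only that
        \<open>T g B\<close> is in \<open>U\<close>.\<close>
      show "F (g, G (g, F (h, a))) = F (M (g, h), G (g, a))"
        using acts(1)[OF g h a] by (simp add: aB FB B U1 U2 g h M_def i)
      show "F (g, G (g, G (h, a))) = G (M (h, g), F (g, a))"
        using acts(2)[OF g h a] by (simp add: aB FB B U1 U2 g h M_def i)
    qed
  qed
qed

theorem theorem4p3: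
  fixes m :: "real^'n::finite \<Rightarrow> real^'n \<Rightarrow> real^'n"
    and \<A> :: "('x::{t2_space, second_countable_topology}, 'm::finite) chart set"
    and S T :: "real^'n \<Rightarrow> 'x \<Rightarrow> 'x"
    and x y z :: "real^'n"
  assumes "local_analytic_moufang_loop m"
    and "analytic_atlas \<A>"
    and "moufang_action m \<A> S T"
  shows "\<forall>(U, \<phi>)\<in>\<A>. \<forall>A\<in>U.
    6 *\<^sub>R vf_bracket (yamagutian (U, \<phi>) S T x y) (inf_transf (U, \<phi>) S z) (\<phi> A)
      = inf_transf (U, \<phi>) S (yamaguti_bracket m x y z) (\<phi> A) \<and>
    6 *\<^sub>R vf_bracket (yamagutian (U, \<phi>) S T x y) (inf_transf (U, \<phi>) T z) (\<phi> A)
      = inf_transf (U, \<phi>) T (yamaguti_bracket m x y z) (\<phi> A) \<and>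
    6 *\<^sub>R vf_bracket (yamagutian (U, \<phi>) S T x y) (inf_transf_P (U, \<phi>) S T z) (\<phi> A)
      = inf_transf_P (U, \<phi>) S T (yamaguti_bracket m x y z) (\<phi> A)"
proof clarify
  fix U \<phi> A assume c: "(U, \<phi>) \<in> \<A>" and A: "A \<in> U"
  define F where "F = (\<lambda>p. \<phi> (S (fst p) (inv_into U \<phi> (snd p))))"
  define G where "G = (\<lambda>p. \<phi> (T (fst p) (inv_into U \<phi> (snd p))))"
  obtain N V where a: "\<phi> A \<in> V" and pair: "moufang_pair (\<lambda>p. m (fst p) (snd p)) F G N V"
    unfolding F_def G_def by (rule moufang_action_chartE[OF assms c A])
  interpret moufang_pair "\<lambda>p. m (fst p) (snd p)" F G N V by (rule pair)
  let ?S = "inf_transf (U, \<phi>) S" and ?T = "inf_transf (U, \<phi>) T" and ?P = "inf_transf_P (U, \<phi>) S T"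
  have S: "?S w b = generator F w b" if b: "b \<in> V" for w b
  proof -
    have "?S w b = (\<Sum>j\<in>UNIV. (w $ j) *\<^sub>R generator F (axis j 1) b)"
      using partial_deriv_param_local_family[OF F b] by (simp add: inf_transf_def F_def)
    then show ?thesis by (simp add: linear_eq_sum_axis[OF S_linear[OF b]])
  qed
  have T: "?T w b = generator G w b" if b: "b \<in> V" for w b
  proof -
    have "?T w b = (\<Sum>j\<in>UNIV. (w $ j) *\<^sub>R generator G (axis j 1) b)"
      using partial_deriv_param_local_family[OF G b] by (simp add: inf_transf_def G_def)
    then show ?thesis by (simp add: linear_eq_sum_axis[OF T_linear[OF b]])
  qed
  have P: "?P w b = - generator F w b - generator G w b" if "b \<in> V" for w b
    by (simp add: inf_transf_P_def S T that)
  have dP: "(\<lambda>b. - generator F w b - generator G w b) differentiable (at b)" if "b \<in> V" for w b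
    by (intro differentiable_diff differentiable_minus S1 T1 that)
  let ?Y = "six_yamagutian (generator F) (generator G) x y"
  have Y: "yamagutian (U, \<phi>) S T x y b = (1/6) *\<^sub>R ?Y b" if b: "b \<in> V" for b
  proof -
    have "vf_bracket (?S x) (?S y) b = vf_bracket (generator F x) (generator F y) b"
      by (rule vf_bracket_cong[OF S1[OF b] S1[OF b]]) (auto intro: eventually_V[OF b] simp: S)
    moreover have "vf_bracket (?T x) (?T y) b = vf_bracket (generator G x) (generator G y) b"
      by (rule vf_bracket_cong[OF T1[OF b] T1[OF b]]) (auto intro: eventually_V[OF b] simp: T)
    moreover have "vf_bracket (?P x) (?P y) b = vf_bracket (\<lambda>b. - generator F x b - generator G x b)
        (\<lambda>b. - generator F y b - generator G y b) b"
      by (rule vf_bracket_cong[OF dP[OF b] dP[OF b]]) (auto intro: eventually_V[OF b] simp: P)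
    ultimately show ?thesis by (simp add: yamagutian_def six_yamagutian_def)
  qed
  note dY = six_yamagutian_differentiable[OF a, of x y]
  \<comment> \<open>\<open>X\<close> stands for a field computed from the chart, \<open>Z\<close>
    for the expression in generators that agrees with it on \<open>V\<close> and is known to be
    differentiable.\<close>
  have main: "6 *\<^sub>R vf_bracket (yamagutian (U, \<phi>) S T x y) X (\<phi> A) = vf_bracket ?Y Z (\<phi> A)"
    if Z: "Z differentiable (at (\<phi> A))" and ev: "\<And>b. b \<in> V \<Longrightarrow> Z b = X b" for X Z
  proof -
    \<comment> \<open>The zero summand gives the multiple of \<open>?Y\<close> the shape of
      \<open>vf_bracket_lincomb_left\<close>.\<close>
    have d: "(\<lambda>b. (1/6) *\<^sub>R ?Y b + 0 *\<^sub>R ?Y b) differentiable (at (\<phi> A))"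
      by (intro differentiable_add differentiable_scaleR differentiable_const dY)
    have "vf_bracket (yamagutian (U, \<phi>) S T x y) X (\<phi> A)
        = vf_bracket (\<lambda>b. (1/6) *\<^sub>R ?Y b + 0 *\<^sub>R ?Y b) Z (\<phi> A)"
      by (rule vf_bracket_cong[OF d Z]) (auto intro!: eventually_V[OF a] simp: Y ev)
    then show ?thesis
      unfolding vf_bracket_lincomb_left[OF dY dY Z] by simp
  qed
  note K = bracket_six_yamagutian_S_T[OF a, of x y z, folded triple_bracket_def, folded yamaguti_bracket_eq[OF assms(1)]]
  show "6 *\<^sub>R vf_bracket (yamagutian (U, \<phi>) S T x y) (?S z) (\<phi> A) = ?S (yamaguti_bracket m x y z) (\<phi> A) \<and>
    6 *\<^sub>R vf_bracket (yamagutian (U, \<phi>) S T x y) (?T z) (\<phi> A) = ?T (yamaguti_bracket m x y z) (\<phi> A) \<and>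
    6 *\<^sub>R vf_bracket (yamagutian (U, \<phi>) S T x y) (?P z) (\<phi> A) = ?P (yamaguti_bracket m x y z) (\<phi> A)"
    \<comment> \<open>The equation for \<open>P\<close> follows from the other two, as
      \<open>P\<close> is minus the sum of \<open>S\<close> and \<open>T\<close> and the bracket is
      additive in its second argument.\<close>
    by (simp add: main[OF S1[OF a, of z]] main[OF T1[OF a, of z]] main[OF dP[OF a, of z]] S T P a K
        vf_bracket_neg_sum_right S1[OF a] T1[OF a] dY)
qed

end
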